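(* Let $\mathbb K$ be a field and $d\ge0$ an integer. The map sending a TH system to its parameter array induces a bijection from the set of isomorphism classes of TH systems over $\mathbb K$ of diameter $d$ to the set of parameter arrays over $\mathbb K$ of diameter $d$; this bijection in turn induces a bijection from the set of affine isomorphism classes of TH systems over $\mathbb K$ of diameter $d$ to the set of reduced parameter arrays over $\mathbb K$ of diameter $d$.
   Context: The symbol $*$ is only notation. Let $V$ be a $\mathbb K$-vector space of dimension $d+1$. An element of $\mathrm{End}(V)$ is multiplicity-free if it is diagonalizable and all its eigenspaces have dimension one; the primitive idempotent attached to an eigenspace acts as the identity on it and as $0$ on the other eigenspaces. A TH system on $V$ (of diameter $d$, over $\mathbb K$) is a sequence $\Phi=(A;\{E_i\}_{i=0}^d;A^*;\{E^*_i\}_{i=0}^d)$ such that $A,A^*\in\mathrm{End}(V)$ are multiplicity-free; $\{E_i\}$ (resp. $\{E_i^*\}$) is an ordering of the primitive idempotents of $A$ (resp. $A^*$); and for $0\le i,j\le d$, each of $E_iA^*E_j$ and $E^*_iAE^*_j$ is $0$ if $i-j>1$ and nonzero if $i-j=1$. The eigenvalue sequence $\{\theta_i\}$ (resp. dual eigenvalue sequence $\{\theta_i^*\}$): $\theta_i$ (resp. $\theta_i^*$) is the eigenvalue of $A$ (resp. $A^*$) corresponding to $E_i$ (resp. $E_i^*$). TH systems $(A;\{E_i\};A^*;\{E_i^*\})$ on $V$ and $(B;\{F_i\};B^*;\{F_i^*\})$ on $W$ are isomorphic if there is a $\mathbb K$-algebra isomorphism $\gamma:\mathrm{End}(V)\to\mathrm{End}(W)$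 with $B=A^\gamma$, $B^*=A^{*\gamma}$, $F_i=E_i^\gamma$, $F_i^*=E_i^{*\gamma}$ for all $i$. An affine transformation of $\Phi$ is a TH system $(\alpha A+\beta I;\{E_i\};\alpha^*A^*+\beta^*I;\{E_i^*\})$ with $\alpha,\beta,\alpha^*,\beta^*\in\mathbb K$ and $\alpha,\alpha^*$ nonzero. $\Phi$ and $\Phi'$ are affine isomorphic if $\Phi$ is isomorphic to an affine transformation of $\Phi'$; this is an equivalence relation. Split sequence: for $0\le i\le d$ put $U_i=(E^*_0V+\cdots+E^*_iV)\cap(E_0V+\cdots+E_{d-i}V)$. It is known that the $U_i$ are one-dimensional, $V=\bigoplus_i U_i$, and (with $U_{-1}=U_{d+1}=0$) $(A-\theta_{d-i}I)U_i=U_{i+1}$, $(A^*-\theta^*_iI)U_i=U_{i-1}$. For $1\le i\le d$, $\phi_i$ is the (nonzero) eigenvalue of $(A-\theta_{d-i+1}I)(A^*-\theta_i^*I)$ on $U_i$. The parameter array of $\Phi$ is $(\{\theta_i\}_{i=0}^d,\{\theta_i^*\}_{i=0}^d,\{\phi_i\}_{i=1}^d)$. A parameter array over $\mathbb K$ of diameter $d$ is a sequence of scalars $(\{\theta_i\}_{i=0}^d,\{\theta_i^*\}_{i=0}^d,\{\phi_i\}_{i=1}^d)$ in $\mathbb K$ with $\{\theta_i\}$ mutually distinct, $\{\theta_i^*\}$ mutually distinct, and all $\phi_i$ nonzero. It is known (earlier classification) that taking parameter arrays gives a bijection from isomorphism classes of TH systems over $\mathbb K$ of diameter $d$ to parameter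 arrays over $\mathbb K$ of diameter $d$. Two parameter arrays $(\{\theta_i\},\{\theta_i^*\},\{\phi_i\})$ and $(\{\theta_i'\},\{\theta_i^{*\prime}\},\{\phi_i'\})$ are affine related if there are $\alpha,\beta,\alpha^*,\beta^*\in\mathbb K$ with $\alpha,\alpha^*$ nonzero such that $\theta_i'=\alpha\theta_i+\beta$, $\theta_i^{*\prime}=\alpha^*\theta_i^*+\beta^*$ $(0\le i\le d)$ and $\phi_i'=\alpha\alpha^*\phi_i$ $(1\le i\le d)$. This is an equivalence relation; its classes are called reduced parameter arrays. *)

theory Defs
  imports "Jordan_Normal_Form.VS_Connect" "HOL-Algebra.QuotRing"
begin

text \<open>The field is the type \<open>'k\<close>, turned into a HOL-Algebra structure by \<^term>\<open>class_ring\<close>.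
  Vector spaces are arbitrary records \<open>V :: ('k, 'v) module\<close>, so that one can quantify over all
  of them whose vectors are taken from the type \<open>'v\<close>. Only the fields
  \<open>carrier\<close>, \<open>add\<close>, \<open>zero\<close> and \<open>smult\<close> of such a record matter.\<close>

definition has_dim :: "('k::field, 'v) module \<Rightarrow> nat \<Rightarrow> bool" where
  "has_dim V n \<longleftrightarrow> vectorspace class_ring V \<and> vectorspace.fin_dim class_ring V
     \<and> vectorspace.dim class_ring V = n"

text \<open>Every type with a large enough vector space on it can serve as \<open>'v\<close>; for instance \<open>'k vec\<close>
  works for all dimensions at once.\<close>

lemma has_dim_module_vec: "has_dim (module_vec TYPE('k::field) n) n"
proof -
  interpret vec_space "TYPE('k)" n .
  show ?thesis
    unfolding has_dim_def using vec_vs fin_dim dim_is_n by auto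
qed

text \<open>Endomorphisms are made extensional (\<^term>\<open>undefined\<close> outside the carrier of \<open>V\<close>), so that
  equality of functions is equality of linear maps.\<close>

definition End_alg :: "('k::field, 'v) module \<Rightarrow> ('k, 'v \<Rightarrow> 'v) module" where
  "End_alg V =
     \<lparr> carrier = LinearCombinations.module_hom class_ring V V \<inter> extensional (carrier V),
       mult = (\<lambda>f g. compose (carrier V) f g),
       one = (\<lambda>v\<in>carrier V. v),
       zero = (\<lambda>v\<in>carrier V. \<zero>\<^bsub>V\<^esub>),
       add = (\<lambda>f g. \<lambda>v\<in>carrier V. f v \<oplus>\<^bsub>V\<^esub> g v),
       smult = (\<lambda>c f. \<lambda>v\<in>carrier V. c \<odot>\<^bsub>V\<^esub> f v) \<rparr>"

definition alg_iso :: "('k::field, 'a) module \<Rightarrow> ('k, 'b) module \<Rightarrow> ('a \<Rightarrow> 'b) set" where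
  "alg_iso R S = {\<gamma> \<in> ring_iso R S. \<forall>c. \<forall>x\<in>carrier R. \<gamma> (c \<odot>\<^bsub>R\<^esub> x) = c \<odot>\<^bsub>S\<^esub> \<gamma> x}"

definition eigsp :: "('k::field, 'v) module \<Rightarrow> ('v \<Rightarrow> 'v) \<Rightarrow> 'k \<Rightarrow> 'v set" where
  "eigsp V f c = {v \<in> carrier V. f v = c \<odot>\<^bsub>V\<^esub> v}"

definition eigvals :: "('k::field, 'v) module \<Rightarrow> ('v \<Rightarrow> 'v) \<Rightarrow> 'k set" where
  "eigvals V f = {c. \<exists>v\<in>eigsp V f c. v \<noteq> \<zero>\<^bsub>V\<^esub>}"

definition diagonalizable :: "('k::field, 'v) module \<Rightarrow> ('v \<Rightarrow> 'v) \<Rightarrow> bool" where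
  "diagonalizable V f \<longleftrightarrow> (\<exists>B. vectorspace.basis class_ring V B \<and> (\<forall>b\<in>B. \<exists>c. b \<in> eigsp V f c))"

definition mult_free :: "('k::field, 'v) module \<Rightarrow> ('v \<Rightarrow> 'v) \<Rightarrow> bool" where
  "mult_free V f \<longleftrightarrow> f \<in> carrier (End_alg V) \<and> diagonalizable V f
     \<and> (\<forall>c\<in>eigvals V f. has_dim (V\<lparr>carrier := eigsp V f c\<rparr>) 1)"

definition prim_idem :: "('k::field, 'v) module \<Rightarrow> ('v \<Rightarrow> 'v) \<Rightarrow> 'k \<Rightarrow> ('v \<Rightarrow> 'v) \<Rightarrow> bool" where
  "prim_idem V f c e \<longleftrightarrow> c \<in> eigvals V f \<and> e \<in> carrier (End_alg V)
     \<and> (\<forall>v\<in>eigsp V f c. e v = v)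
     \<and> (\<forall>c'\<in>eigvals V f. c' \<noteq> c \<longrightarrow> (\<forall>v\<in>eigsp V f c'. e v = \<zero>\<^bsub>V\<^esub>))"

text \<open>A finite sequence indexed by \<open>0, \<dots>, d\<close> (or \<open>1, \<dots>, d\<close>) is an extensional function on
  that index set.\<close>

definition idem_ordering ::
  "nat \<Rightarrow> ('k::field, 'v) module \<Rightarrow> ('v \<Rightarrow> 'v) \<Rightarrow> (nat \<Rightarrow> 'v \<Rightarrow> 'v) \<Rightarrow> bool" where
  "idem_ordering d V f E \<longleftrightarrow>
     E \<in> extensional {0..d} \<and> bij_betw E {0..d} {e. \<exists>c. prim_idem V f c e}"

text \<open>The final \<open>s\<close> of a name stands for the superscript star: \<open>opAs\<close> is \<open>A*\<close>, \<open>idEs\<close> is \<open>E*\<close>,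
  \<open>\<theta>s\<close> is the dual eigenvalue sequence. The diameter \<open>d\<close> is a parameter of \<open>TH_systems\<close> below; it is
  determined by the dimension of \<open>sp\<close>.\<close>

record ('k, 'v) th_sys =
  sp :: "('k, 'v) module"
  opA :: "'v \<Rightarrow> 'v"
  idE :: "nat \<Rightarrow> 'v \<Rightarrow> 'v"
  opAs :: "'v \<Rightarrow> 'v"
  idEs :: "nat \<Rightarrow> 'v \<Rightarrow> 'v"

definition TH_systems :: "nat \<Rightarrow> ('k::field, 'v) th_sys set" where
  "TH_systems d = {\<Phi>.
     let V = sp \<Phi>; A = opA \<Phi>; E = idE \<Phi>; As = opAs \<Phi>; Es = idEs \<Phi>; X = End_alg V in
       has_dim V (d + 1)
     \<and> mult_free V A \<and> mult_free V As
     \<and> idem_ordering d V A E \<and> idem_ordering d V As Es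
     \<and> (\<forall>i\<in>{0..d}. \<forall>j\<in>{0..d}.
          (i > j + 1 \<longrightarrow> E i \<otimes>\<^bsub>X\<^esub> As \<otimes>\<^bsub>X\<^esub> E j = \<zero>\<^bsub>X\<^esub>)
        \<and> (i = j + 1 \<longrightarrow> E i \<otimes>\<^bsub>X\<^esub> As \<otimes>\<^bsub>X\<^esub> E j \<noteq> \<zero>\<^bsub>X\<^esub>)
        \<and> (i > j + 1 \<longrightarrow> Es i \<otimes>\<^bsub>X\<^esub> A \<otimes>\<^bsub>X\<^esub> Es j = \<zero>\<^bsub>X\<^esub>)
        \<and> (i = j + 1 \<longrightarrow> Es i \<otimes>\<^bsub>X\<^esub> A \<otimes>\<^bsub>X\<^esub> Es j \<noteq> \<zero>\<^bsub>X\<^esub>))}"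

definition th_isomorphic :: "nat \<Rightarrow> ('k::field, 'v) th_sys \<Rightarrow> ('k, 'w) th_sys \<Rightarrow> bool" where
  "th_isomorphic d \<Phi> \<Psi> \<longleftrightarrow> (\<exists>\<gamma>\<in>alg_iso (End_alg (sp \<Phi>)) (End_alg (sp \<Psi>)).
     opA \<Psi> = \<gamma> (opA \<Phi>) \<and> opAs \<Psi> = \<gamma> (opAs \<Phi>)
     \<and> (\<forall>i\<in>{0..d}. idE \<Psi> i = \<gamma> (idE \<Phi> i) \<and> idEs \<Psi> i = \<gamma> (idEs \<Phi> i)))"

definition th_affine ::
  "'k \<Rightarrow> 'k \<Rightarrow> 'k \<Rightarrow> 'k \<Rightarrow> ('k::field, 'v) th_sys \<Rightarrow> ('k, 'v) th_sys" where
  "th_affine \<alpha> \<beta> \<alpha>s \<beta>s \<Phi> = (let X = End_alg (sp \<Phi>) in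
     \<Phi>\<lparr>opA := \<alpha> \<odot>\<^bsub>X\<^esub> opA \<Phi> \<oplus>\<^bsub>X\<^esub> \<beta> \<odot>\<^bsub>X\<^esub> \<one>\<^bsub>X\<^esub>,
       opAs := \<alpha>s \<odot>\<^bsub>X\<^esub> opAs \<Phi> \<oplus>\<^bsub>X\<^esub> \<beta>s \<odot>\<^bsub>X\<^esub> \<one>\<^bsub>X\<^esub>\<rparr>)"

definition th_iso_rel :: "nat \<Rightarrow> (('k::field, 'v) th_sys \<times> ('k, 'v) th_sys) set" where
  "th_iso_rel d = {(\<Phi>, \<Psi>) \<in> TH_systems d \<times> TH_systems d. th_isomorphic d \<Phi> \<Psi>}"

text \<open>The affine transformation is applied to the second argument, and it has to be a TH
  system itself.\<close>

definition th_affine_iso_rel :: "nat \<Rightarrow> (('k::field, 'v) th_sys \<times> ('k, 'v) th_sys) set" where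
  "th_affine_iso_rel d = {(\<Phi>, \<Phi>') \<in> TH_systems d \<times> TH_systems d.
     \<exists>\<alpha> \<beta> \<alpha>s \<beta>s. \<alpha> \<noteq> 0 \<and> \<alpha>s \<noteq> 0 \<and> th_affine \<alpha> \<beta> \<alpha>s \<beta>s \<Phi>' \<in> TH_systems d
        \<and> th_isomorphic d \<Phi> (th_affine \<alpha> \<beta> \<alpha>s \<beta>s \<Phi>')}"

definition eig_seq :: "nat \<Rightarrow> ('k::field, 'v) th_sys \<Rightarrow> nat \<Rightarrow> 'k" where
  "eig_seq d \<Phi> = (\<lambda>i\<in>{0..d}. THE c. prim_idem (sp \<Phi>) (opA \<Phi>) c (idE \<Phi> i))"

definition dual_eig_seq :: "nat \<Rightarrow> ('k::field, 'v) th_sys \<Rightarrow> nat \<Rightarrow> 'k" where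
  "dual_eig_seq d \<Phi> = (\<lambda>i\<in>{0..d}. THE c. prim_idem (sp \<Phi>) (opAs \<Phi>) c (idEs \<Phi> i))"

text \<open>The sum of the subspaces \<open>W i\<close>, \<open>i \<in> I\<close>, for finite \<open>I\<close>.\<close>

definition sum_spaces :: "('k::field, 'v) module \<Rightarrow> (nat \<Rightarrow> 'v set) \<Rightarrow> nat set \<Rightarrow> 'v set" where
  "sum_spaces V W I = {finsum V w I | w. \<forall>i\<in>I. w i \<in> W i}"

definition split_space :: "nat \<Rightarrow> ('k::field, 'v) th_sys \<Rightarrow> nat \<Rightarrow> 'v set" where
  "split_space d \<Phi> i =
     sum_spaces (sp \<Phi>) (\<lambda>j. idEs \<Phi> j ` carrier (sp \<Phi>)) {0..i}
     \<inter> sum_spaces (sp \<Phi>) (\<lambda>j. idE \<Phi> j ` carrier (sp \<Phi>)) {0..d - i}"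

text \<open>The scalar is unique because \<open>split_space d \<Phi> i\<close> is one-dimensional for a TH system
  \<open>\<Phi>\<close>.\<close>

definition split_seq :: "nat \<Rightarrow> ('k::field, 'v) th_sys \<Rightarrow> nat \<Rightarrow> 'k" where
  "split_seq d \<Phi> = (\<lambda>i\<in>{1..d}. let X = End_alg (sp \<Phi>) in
     THE c. \<forall>u\<in>split_space d \<Phi> i.
       ((opA \<Phi> \<ominus>\<^bsub>X\<^esub> eig_seq d \<Phi> (d - i + 1) \<odot>\<^bsub>X\<^esub> \<one>\<^bsub>X\<^esub>)
         \<otimes>\<^bsub>X\<^esub> (opAs \<Phi> \<ominus>\<^bsub>X\<^esub> dual_eig_seq d \<Phi> i \<odot>\<^bsub>X\<^esub> \<one>\<^bsub>X\<^esub>)) u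
       = c \<odot>\<^bsub>sp \<Phi>\<^esub> u)"

type_synonym 'k parr = "(nat \<Rightarrow> 'k) \<times> (nat \<Rightarrow> 'k) \<times> (nat \<Rightarrow> 'k)"

definition parr_of :: "nat \<Rightarrow> ('k::field, 'v) th_sys \<Rightarrow> 'k parr" where
  "parr_of d \<Phi> = (eig_seq d \<Phi>, dual_eig_seq d \<Phi>, split_seq d \<Phi>)"

definition param_arrays :: "nat \<Rightarrow> 'k::field parr set" where
  "param_arrays d = {(\<theta>, \<theta>s, \<phi>).
     \<theta> \<in> extensional {0..d} \<and> \<theta>s \<in> extensional {0..d} \<and> \<phi> \<in> extensional {1..d}
     \<and> inj_on \<theta> {0..d} \<and> inj_on \<theta>s {0..d} \<and> (\<forall>i\<in>{1..d}. \<phi> i \<noteq> 0)}"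

definition affine_related :: "nat \<Rightarrow> ('k::field parr \<times> 'k parr) set" where
  "affine_related d = {((\<theta>, \<theta>s, \<phi>), (\<theta>', \<theta>s', \<phi>')).
     (\<theta>, \<theta>s, \<phi>) \<in> param_arrays d \<and> (\<theta>', \<theta>s', \<phi>') \<in> param_arrays d
     \<and> (\<exists>\<alpha> \<beta> \<alpha>s \<beta>s. \<alpha> \<noteq> 0 \<and> \<alpha>s \<noteq> 0
          \<and> (\<forall>i\<in>{0..d}. \<theta>' i = \<alpha> * \<theta> i + \<beta> \<and> \<theta>s' i = \<alpha>s * \<theta>s i + \<beta>s)
          \<and> (\<forall>i\<in>{1..d}. \<phi>' i = \<alpha> * \<alpha>s * \<phi> i))}"

end

theory Submission
  imports Defs
begin

text \<open>
  Everything rests on one basis attached to a TH system. Let \<open>v i\<close> and \<open>e i\<close> span the images of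
  \<open>E i\<close> and \<open>E* i\<close>. The vanishing and non-vanishing conditions say that \<open>A\<close> raises the flag of the
  \<open>e i\<close> by exactly one step and \<open>A*\<close> raises the flag of the \<open>v i\<close> by exactly one step. Hence
  \<open>e 0\<close> is a cyclic vector for \<open>A\<close>, and the vectors
  \<open>u i = (A - \<theta> (d - i + 1)) \<dots> (A - \<theta> d) (e 0)\<close> form a basis which is triangular with respect to
  the \<open>e i\<close> and, read backwards, triangular with respect to the \<open>v i\<close>. The two triangularities
  identify the split space \<open>U i\<close> with the line through \<open>u i\<close> and force \<open>A\<close> to be lower bidiagonal
  (diagonal \<open>\<theta> (d - i)\<close>, subdiagonal \<open>1\<close>) and \<open>A*\<close> to be upper bidiagonal (diagonal \<open>\<theta>* i\<close>,
  superdiagonal \<open>\<phi> i\<close>) in the basis \<open>u\<close>; none of the \<open>\<phi> i\<close> vanishes, because otherwise \<open>A*\<close>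
  would fail to raise the flag of the \<open>v i\<close>. This is \<open>split_frame_exists\<close>, and
  \<open>parr_of_eq\<close> reads off the parameter array from these matrices.

  The bijection on isomorphism classes follows. Two systems with the same parameter array have the
  same matrices in their split bases, so the linear map matching these bases induces an isomorphism
  (\<open>parr_eq_imp_isomorphic\<close>). Conversely, each entry of the parameter array is determined by an
  equation between elements of the endomorphism algebra, and such equations survive an algebra
  isomorphism (\<open>isomorphic_imp_parr_eq\<close>). Finally, given a parameter array, the two bidiagonal
  matrices are triangular with distinct diagonal entries, hence diagonalizable by triangular changes
  of basis, and these do not disturb the raising conditions (\<open>split_frame_of_parr\<close>).

  For the affine statement, replacing \<open>A\<close> by \<open>\<alpha> A + \<beta>\<close> and \<open>A*\<close> by \<open>\<alpha>* A* + \<beta>*\<close> rescales \<open>u i\<close> by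
  \<open>\<alpha> ^ i\<close> and turns \<open>\<phi> i\<close> into \<open>\<alpha> \<alpha>* \<phi> i\<close> (\<open>split_frame_affine\<close>). So both equivalence relations
  on TH systems are pulled back along the map taking parameter arrays, from equality and from affine
  relatedness respectively, and \<open>quotient_by_kernel\<close> gives the two bijections.
\<close>

section \<open>The endomorphism algebra of a vector space\<close>

lemma carrier_End:
  "f \<in> carrier (End_alg V) \<longleftrightarrow> f \<in> carrier V \<rightarrow> carrier V
     \<and> (\<forall>x\<in>carrier V. \<forall>y\<in>carrier V. f (x \<oplus>\<^bsub>V\<^esub> y) = f x \<oplus>\<^bsub>V\<^esub> f y)
     \<and> (\<forall>c. \<forall>x\<in>carrier V. f (c \<odot>\<^bsub>V\<^esub> x) = c \<odot>\<^bsub>V\<^esub> f x)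
     \<and> f \<in> extensional (carrier V)"
  by (auto simp: End_alg_def LinearCombinations.module_hom_def class_ring_simps)

lemma End_closed: "f \<in> carrier (End_alg V) \<Longrightarrow> x \<in> carrier V \<Longrightarrow> f x \<in> carrier V"
  and End_add: "f \<in> carrier (End_alg V) \<Longrightarrow> x \<in> carrier V \<Longrightarrow> y \<in> carrier V
    \<Longrightarrow> f (x \<oplus>\<^bsub>V\<^esub> y) = f x \<oplus>\<^bsub>V\<^esub> f y"
  and End_smult: "f \<in> carrier (End_alg V) \<Longrightarrow> x \<in> carrier V \<Longrightarrow> f (c \<odot>\<^bsub>V\<^esub> x) = c \<odot>\<^bsub>V\<^esub> f x"
  by (auto simp: carrier_End)

lemma End_eqI:
  assumes "f \<in> carrier (End_alg V)" "g \<in> carrier (End_alg V)" "\<And>x. x \<in> carrier V \<Longrightarrow> f x = g x"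
  shows "f = g"
  using assms by (auto simp: carrier_End intro: extensionalityI)

lemma End_mult_apply: "x \<in> carrier V \<Longrightarrow> (f \<otimes>\<^bsub>End_alg V\<^esub> g) x = f (g x)"
  and End_add_apply: "x \<in> carrier V \<Longrightarrow> (f \<oplus>\<^bsub>End_alg V\<^esub> g) x = f x \<oplus>\<^bsub>V\<^esub> g x"
  and End_smult_apply: "x \<in> carrier V \<Longrightarrow> (c \<odot>\<^bsub>End_alg V\<^esub> f) x = c \<odot>\<^bsub>V\<^esub> f x"
  and End_one_apply: "x \<in> carrier V \<Longrightarrow> (\<one>\<^bsub>End_alg V\<^esub>) x = x"
  and End_zero_apply: "x \<in> carrier V \<Longrightarrow> (\<zero>\<^bsub>End_alg V\<^esub>) x = \<zero>\<^bsub>V\<^esub>"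
  by (simp_all add: End_alg_def compose_def)

lemmas End_apply = End_mult_apply End_add_apply End_smult_apply End_one_apply End_zero_apply

locale vspace = vectorspace class_ring V for V :: "('k::field, 'v) module"
begin

lemma smult_in [simp]: "x \<in> carrier V \<Longrightarrow> c \<odot>\<^bsub>V\<^esub> x \<in> carrier V"
  using smult_closed by (simp add: class_ring_simps)

lemma zero_smult [simp]: "x \<in> carrier V \<Longrightarrow> 0 \<odot>\<^bsub>V\<^esub> x = \<zero>\<^bsub>V\<^esub>"
  using lmult_0 by (simp add: class_ring_simps)

lemma one_smult [simp]: "x \<in> carrier V \<Longrightarrow> 1 \<odot>\<^bsub>V\<^esub> x = x"
  using smult_one by (simp add: class_ring_simps)

lemma smult_zero [simp]: "c \<odot>\<^bsub>V\<^esub> \<zero>\<^bsub>V\<^esub> = \<zero>\<^bsub>V\<^esub>"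
  using rmult_0 by (simp add: class_ring_simps)

lemma smult_smult: "x \<in> carrier V \<Longrightarrow> c \<odot>\<^bsub>V\<^esub> (e \<odot>\<^bsub>V\<^esub> x) = (c * e) \<odot>\<^bsub>V\<^esub> x"
  using smult_assoc1[of c e x] by (simp add: class_ring_simps)

lemma add_smult: "x \<in> carrier V \<Longrightarrow> (c + e) \<odot>\<^bsub>V\<^esub> x = c \<odot>\<^bsub>V\<^esub> x \<oplus>\<^bsub>V\<^esub> e \<odot>\<^bsub>V\<^esub> x"
  using smult_l_distr[of c e x] by (simp add: class_ring_simps)

lemma smult_add: "x \<in> carrier V \<Longrightarrow> y \<in> carrier V
    \<Longrightarrow> c \<odot>\<^bsub>V\<^esub> (x \<oplus>\<^bsub>V\<^esub> y) = c \<odot>\<^bsub>V\<^esub> x \<oplus>\<^bsub>V\<^esub> c \<odot>\<^bsub>V\<^esub> y"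
  using smult_r_distr[of c x y] by (simp add: class_ring_simps)

lemma minus_smult: "x \<in> carrier V \<Longrightarrow> (- c) \<odot>\<^bsub>V\<^esub> x = \<ominus>\<^bsub>V\<^esub> (c \<odot>\<^bsub>V\<^esub> x)"
  using smult_l_minus[of c x] by (simp add: class_ring_simps)

lemma End_alg_closed: "f \<in> carrier (End_alg V) \<Longrightarrow> g \<in> carrier (End_alg V) \<Longrightarrow> f \<otimes>\<^bsub>End_alg V\<^esub> g \<in> carrier (End_alg V)"
  "f \<in> carrier (End_alg V) \<Longrightarrow> g \<in> carrier (End_alg V) \<Longrightarrow> f \<oplus>\<^bsub>End_alg V\<^esub> g \<in> carrier (End_alg V)"
  "f \<in> carrier (End_alg V) \<Longrightarrow> c \<odot>\<^bsub>End_alg V\<^esub> f \<in> carrier (End_alg V)"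
  "\<one>\<^bsub>End_alg V\<^esub> \<in> carrier (End_alg V)"
  "\<zero>\<^bsub>End_alg V\<^esub> \<in> carrier (End_alg V)"
proof -
  have ext: "f \<otimes>\<^bsub>End_alg V\<^esub> g \<in> extensional (carrier V)" "f \<oplus>\<^bsub>End_alg V\<^esub> g \<in> extensional (carrier V)"
    "c \<odot>\<^bsub>End_alg V\<^esub> f \<in> extensional (carrier V)" "\<one>\<^bsub>End_alg V\<^esub> \<in> extensional (carrier V)"
    "\<zero>\<^bsub>End_alg V\<^esub> \<in> extensional (carrier V)"
    by (simp_all add: End_alg_def)
  show "f \<in> carrier (End_alg V) \<Longrightarrow> g \<in> carrier (End_alg V) \<Longrightarrow> f \<otimes>\<^bsub>End_alg V\<^esub> g \<in> carrier (End_alg V)"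
    using ext by (auto simp: carrier_End End_apply Pi_def)
  show "f \<in> carrier (End_alg V) \<Longrightarrow> g \<in> carrier (End_alg V) \<Longrightarrow> f \<oplus>\<^bsub>End_alg V\<^esub> g \<in> carrier (End_alg V)"
    using ext by (auto simp: carrier_End End_apply Pi_def smult_add a_ac)
  show "f \<in> carrier (End_alg V) \<Longrightarrow> c \<odot>\<^bsub>End_alg V\<^esub> f \<in> carrier (End_alg V)"
    using ext by (auto simp: carrier_End End_apply Pi_def smult_add smult_smult mult.commute)
  show "\<one>\<^bsub>End_alg V\<^esub> \<in> carrier (End_alg V)"
    using ext by (auto simp: carrier_End End_apply Pi_def)
  show "\<zero>\<^bsub>End_alg V\<^esub> \<in> carrier (End_alg V)"
    using ext by (auto simp: carrier_End End_apply Pi_def)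
qed

text \<open>Subtraction in \<^const>\<open>End_alg\<close> is defined through the additive inverse, that is, through a
  definite description in the additive monoid. Evaluating it pointwise therefore requires the
  group axioms of this monoid.\<close>
lemma End_minus_apply:
  assumes "f \<in> carrier (End_alg V)" "g \<in> carrier (End_alg V)" "x \<in> carrier V"
  shows "(f \<ominus>\<^bsub>End_alg V\<^esub> g) x = f x \<oplus>\<^bsub>V\<^esub> (- 1) \<odot>\<^bsub>V\<^esub> g x"
proof -
  let ?X = "End_alg V"
  have 1: "f \<oplus>\<^bsub>?X\<^esub> g = g \<oplus>\<^bsub>?X\<^esub> f" if "f \<in> carrier ?X" "g \<in> carrier ?X" for f g
    by (rule End_eqI[of _ V]) (use that in \<open>auto simp: End_alg_closed End_apply End_closed a_comm\<close>)
  have 2: "\<zero>\<^bsub>?X\<^esub> \<oplus>\<^bsub>?X\<^esub> f = f" if "f \<in> carrier ?X" for f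
    by (rule End_eqI[of _ V]) (use that in \<open>auto simp: End_alg_closed End_apply End_closed\<close>)
  have 3: "((- 1) \<odot>\<^bsub>?X\<^esub> f) \<oplus>\<^bsub>?X\<^esub> f = \<zero>\<^bsub>?X\<^esub>" if "f \<in> carrier ?X" for f
    by (rule End_eqI[of _ V]) (use that in \<open>auto simp: End_alg_closed End_apply End_closed minus_smult l_neg\<close>)
  interpret X: abelian_group ?X
  proof (rule abelian_groupI)
    fix f assume f: "f \<in> carrier ?X"
    show "\<exists>h\<in>carrier ?X. h \<oplus>\<^bsub>?X\<^esub> f = \<zero>\<^bsub>?X\<^esub>"
      using 3[OF f] f End_alg_closed(3) by blast
  qed (fact End_alg_closed 1 2 | rule End_eqI[of _ V], auto simp: End_alg_closed End_apply End_closed a_assoc)+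
  have "\<ominus>\<^bsub>?X\<^esub> g = (- 1) \<odot>\<^bsub>?X\<^esub> g"
    using X.minus_equality 3 assms End_alg_closed(3) by blast
  then show ?thesis using assms by (simp add: a_minus_def End_apply)
qed

end

section \<open>Coordinates with respect to an indexed basis\<close>

text \<open>A basis \<open>v 0, \<dots>, v d\<close> is kept together with its coordinate functionals \<open>a _ k\<close>. Vectors are
  then compared coordinate by coordinate in the field itself, and subspaces spanned by part of the
  basis are described by the vanishing of coordinates. Only the values \<open>a x k\<close> with \<open>x\<close> in the
  carrier and \<open>k \<le> d\<close> carry information.\<close>
locale frame = vspace V for V :: "('k::field, 'v) module" +
  fixes d :: nat and v :: "nat \<Rightarrow> 'v" and a :: "'v \<Rightarrow> nat \<Rightarrow> 'k"
  assumes v_in [simp]: "i \<le> d \<Longrightarrow> v i \<in> carrier V"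
    and a_add [simp]: "x \<in> carrier V \<Longrightarrow> y \<in> carrier V \<Longrightarrow> k \<le> d \<Longrightarrow> a (x \<oplus>\<^bsub>V\<^esub> y) k = a x k + a y k"
    and a_smult [simp]: "x \<in> carrier V \<Longrightarrow> k \<le> d \<Longrightarrow> a (c \<odot>\<^bsub>V\<^esub> x) k = c * a x k"
    and a_v: "i \<le> d \<Longrightarrow> k \<le> d \<Longrightarrow> a (v i) k = (if k = i then 1 else 0)"
    and a_eqI: "x \<in> carrier V \<Longrightarrow> y \<in> carrier V \<Longrightarrow> (\<And>k. k \<le> d \<Longrightarrow> a x k = a y k) \<Longrightarrow> x = y"
begin

lemma a_zero [simp]: "k \<le> d \<Longrightarrow> a \<zero>\<^bsub>V\<^esub> k = 0"
  using a_smult[of "\<zero>\<^bsub>V\<^esub>" k 0] by (simp del: a_smult)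

lemma functional_finsum:
  fixes g :: "'v \<Rightarrow> 'k"
  assumes "\<And>x y. x \<in> carrier V \<Longrightarrow> y \<in> carrier V \<Longrightarrow> g (x \<oplus>\<^bsub>V\<^esub> y) = g x + g y"
    and "\<And>c x. x \<in> carrier V \<Longrightarrow> g (c \<odot>\<^bsub>V\<^esub> x) = c * g x"
    and "finite I" "w \<in> I \<rightarrow> carrier V"
  shows "g (finsum V w I) = (\<Sum>i\<in>I. g (w i))"
  using assms(3,4)
proof (induction I rule: finite_induct)
  case empty
  have "g \<zero>\<^bsub>V\<^esub> = g (0 \<odot>\<^bsub>V\<^esub> \<zero>\<^bsub>V\<^esub>)" by simp
  also have "\<dots> = 0" by (subst assms(2)) auto
  finally show ?case by simp
next
  case (insert i I)
  then show ?case by (auto simp: assms(1) finsum_insert finsum_closed Pi_def)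
qed

definition vec_of :: "(nat \<Rightarrow> 'k) \<Rightarrow> 'v" where
  "vec_of c = finsum V (\<lambda>i. c i \<odot>\<^bsub>V\<^esub> v i) {0..d}"

lemma vec_of_in [simp]: "vec_of c \<in> carrier V"
  unfolding vec_of_def by (rule finsum_closed) auto

lemma a_vec_of [simp]:
  assumes "k \<le> d" shows "a (vec_of c) k = c k"
proof -
  have "a (vec_of c) k = (\<Sum>i\<in>{0..d}. a (c i \<odot>\<^bsub>V\<^esub> v i) k)"
    unfolding vec_of_def using assms by (intro functional_finsum[where g = "\<lambda>x. a x k"]) auto
  also have "\<dots> = (\<Sum>i\<in>{0..d}. if i = k then c i else 0)"
    using assms by (intro sum.cong) (auto simp: a_v)
  also have "\<dots> = c k" using assms by simp
  finally show ?thesis .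
qed

lemma vec_of_a: "x \<in> carrier V \<Longrightarrow> vec_of (a x) = x"
  by (rule a_eqI) auto

lemma functional_expand:
  fixes g :: "'v \<Rightarrow> 'k"
  assumes "\<And>x y. x \<in> carrier V \<Longrightarrow> y \<in> carrier V \<Longrightarrow> g (x \<oplus>\<^bsub>V\<^esub> y) = g x + g y"
    and "\<And>c x. x \<in> carrier V \<Longrightarrow> g (c \<odot>\<^bsub>V\<^esub> x) = c * g x"
    and "x \<in> carrier V"
  shows "g x = (\<Sum>i\<in>{0..d}. a x i * g (v i))"
proof -
  have "g x = g (vec_of (a x))" using assms(3) by (simp add: vec_of_a)
  also have "\<dots> = (\<Sum>i\<in>{0..d}. g (a x i \<odot>\<^bsub>V\<^esub> v i))"
    unfolding vec_of_def using assms by (intro functional_finsum) auto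
  also have "\<dots> = (\<Sum>i\<in>{0..d}. a x i * g (v i))"
    using assms(2) by (intro sum.cong) auto
  finally show ?thesis .
qed

lemma basis_frame: "basis (v ` {0..d})" "inj_on v {0..d}"
proof -
  show inj: "inj_on v {0..d}"
  proof (rule inj_onI)
    fix i j assume ij: "i \<in> {0..d}" "j \<in> {0..d}" "v i = v j"
    then have "a (v j) i = 1" using a_v[of i i] by simp
    then show "i = j" using ij by (auto simp: a_v split: if_splits)
  qed
  have lc: "lincomb c (v ` {0..d}) = vec_of (\<lambda>i. c (v i))" for c
    unfolding lincomb_def vec_of_def using inj by (subst finsum_reindex) auto
  show "basis (v ` {0..d})"
  proof (subst basis_criterion; (intro allI impI ex_ex1I conjI)?)
    fix x assume x: "x \<in> carrier V"
    let ?c = "\<lambda>w\<in>v ` {0..d}. a x (the_inv_into {0..d} v w)"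
    have "lincomb ?c (v ` {0..d}) = x"
      unfolding lc using x by (intro a_eqI) (auto simp: the_inv_into_f_f[OF inj])
    then show "\<exists>c. c \<in> v ` {0..d} \<rightarrow>\<^sub>E carrier class_ring \<and> lincomb c (v ` {0..d}) = x"
      by (intro exI[of _ ?c]) (auto simp: class_ring_simps)
  next
    fix x c e
    assume c: "c \<in> v ` {0..d} \<rightarrow>\<^sub>E carrier class_ring \<and> lincomb c (v ` {0..d}) = x"
      and e: "e \<in> v ` {0..d} \<rightarrow>\<^sub>E carrier class_ring \<and> lincomb e (v ` {0..d}) = x"
    have "c (v i) = e (v i)" if "i \<le> d" for i
      using a_vec_of[OF that, of "\<lambda>i. c (v i)"] a_vec_of[OF that, of "\<lambda>i. e (v i)"] c e
      by (simp add: lc)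
    then show "c = e"
      using c e by (intro extensionalityI[of _ "v ` {0..d}"]) (auto simp: PiE_def)
  qed auto
qed

lemma has_dim_frame: "has_dim V (d + 1)"
proof -
  have "dim = card (v ` {0..d})" by (rule dim_basis) (auto simp: basis_frame)
  then have "dim = d + 1" using basis_frame(2) by (simp add: card_image)
  moreover have "fin_dim" unfolding fin_dim_def using basis_frame(1)
    by (intro exI[of _ "v ` {0..d}"]) (auto simp: basis_def)
  ultimately show ?thesis using vectorspace_axioms by (simp add: has_dim_def)
qed

end

lemma (in vspace) frame_of_basis:
  assumes B: "basis B" and bij: "bij_betw v {0..d} B"
  shows "\<exists>a. frame V d v a"
proof -
  have B': "B \<subseteq> carrier V" "finite B"
    using B bij bij_betw_finite[OF bij] by (auto simp: basis_def)
  have vB: "v i \<in> B" if "i \<le> d" for i using bij that by (auto simp: bij_betw_def)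
  define a where "a x k = (THE c. c \<in> B \<rightarrow>\<^sub>E UNIV \<and> lincomb c B = x) (v k)" for x k
  have ex1: "\<exists>!c. c \<in> B \<rightarrow>\<^sub>E UNIV \<and> lincomb c B = x" if "x \<in> carrier V" for x
    using basis_criterion[OF B'(2,1)] B that by (simp add: class_ring_simps)
  have a: "a x k = c (v k)" if "x \<in> carrier V" "k \<le> d" "lincomb c B = x" for x k c
  proof -
    have "lincomb (restrict c B) B = x"
      unfolding that(3)[symmetric] using B' by (intro lincomb_cong) (auto simp: class_ring_simps)
    then have "(THE c. c \<in> B \<rightarrow>\<^sub>E UNIV \<and> lincomb c B = x) = restrict c B"
      using ex1[OF that(1)] by (intro the1_equality) auto
    then show ?thesis using vB that by (simp add: a_def)
  qed
  have lc: "\<exists>c. lincomb c B = x" if "x \<in> carrier V" for x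
    using ex1[OF that] by blast
  have "frame V d v a"
  proof
    fix i assume "i \<le> d" then show "v i \<in> carrier V" using vB B' by auto
  next
    fix x y k assume *: "x \<in> carrier V" "y \<in> carrier V" "k \<le> d"
    obtain c e where ce: "lincomb c B = x" "lincomb e B = y" using lc * by blast
    have "lincomb (\<lambda>w. c w + e w) B = (\<Oplus>\<^bsub>V\<^esub>w\<in>B. c w \<odot>\<^bsub>V\<^esub> w \<oplus>\<^bsub>V\<^esub> e w \<odot>\<^bsub>V\<^esub> w)"
      unfolding lincomb_def using B' by (intro finsum_cong') (auto simp: add_smult subset_iff)
    also have "\<dots> = x \<oplus>\<^bsub>V\<^esub> y"
      unfolding ce[symmetric] lincomb_def using B' by (intro finsum_addf) auto
    finally have "lincomb (\<lambda>w. c w + e w) B = x \<oplus>\<^bsub>V\<^esub> y" .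
    then show "a (x \<oplus>\<^bsub>V\<^esub> y) k = a x k + a y k"
      using a[of "x \<oplus>\<^bsub>V\<^esub> y" k] a[OF _ _ ce(1)] a[OF _ _ ce(2)] * by simp
  next
    fix x k r assume *: "x \<in> carrier V" "k \<le> d"
    obtain c where c: "lincomb c B = x" using lc * by blast
    have "lincomb (\<lambda>w. r * c w) B = r \<odot>\<^bsub>V\<^esub> x"
      using lincomb_smult[OF B'(1), of c r] c by (simp add: class_ring_simps)
    then show "a (r \<odot>\<^bsub>V\<^esub> x) k = r * a x k"
      using a[of "r \<odot>\<^bsub>V\<^esub> x" k] a[OF _ _ c] * by simp
  next
    fix i k assume *: "i \<le> d" "k \<le> d"
    have "lincomb (\<lambda>w. if w = v i then 1 else 0) B = v i"
    proof -
      have "lincomb (\<lambda>w. if w = v i then 1 else 0) B = finsum V (\<lambda>w. if v i = w then w else \<zero>\<^bsub>V\<^esub>) B"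
        unfolding lincomb_def using B' by (intro finsum_cong') auto
      also have "\<dots> = v i"
        using B' vB * by (intro add.finprod_singleton) auto
      finally show ?thesis .
    qed
    moreover have "v k = v i \<longleftrightarrow> k = i"
      using bij * by (auto simp: bij_betw_def inj_on_def)
    ultimately show "a (v i) k = (if k = i then 1 else 0)"
      using a[of "v i" k "\<lambda>w. if w = v i then 1 else 0"] vB[of i] B' * by auto
  next
    fix x y assume *: "x \<in> carrier V" "y \<in> carrier V" "\<And>k. k \<le> d \<Longrightarrow> a x k = a y k"
    obtain c e where ce: "lincomb c B = x" "lincomb e B = y" using lc * by blast
    have "c (v k) = e (v k)" if "k \<le> d" for k
      using a[OF _ that ce(1)] a[OF _ that ce(2)] *(1,2) *(3)[OF that] by simp
    then have "c w = e w" if "w \<in> B" for w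
      using that bij by (auto simp: bij_betw_def)
    then have "lincomb c B = lincomb e B"
      using B' by (intro lincomb_cong) (auto simp: class_ring_simps)
    then show "x = y" using ce by simp
  qed
  then show ?thesis by blast
qed

lemma frame_exists:
  assumes "has_dim V (d + 1)"
  shows "\<exists>v a. frame V d v a"
proof -
  interpret vspace V using assms by (simp add: has_dim_def vspace_def)
  have "fin_dim" "dim = d + 1" using assms by (auto simp: has_dim_def)
  then obtain B where B: "finite B" "basis B" using finite_basis_exists by blast
  then have "card B = d + 1" using dim_basis \<open>dim = d + 1\<close> by simp
  then obtain v where "bij_betw v {0..d} B"
    using ex_bij_betw_nat_finite[OF B(1)] atLeastLessThanSuc_atLeastAtMost by auto
  then show ?thesis using frame_of_basis[OF B(2)] by blast
qed

context frame begin

lemma expand: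
  assumes "frame V d w b" "x \<in> carrier V" "k \<le> d"
  shows "b x k = (\<Sum>j\<in>{0..d}. a x j * b (v j) k)"
proof -
  interpret b: frame V d w b by fact
  show ?thesis by (rule functional_expand) (use assms in auto)
qed

lemma expand_End:
  assumes "frame V d w b" "f \<in> carrier (End_alg V)" "x \<in> carrier V" "k \<le> d"
  shows "b (f x) k = (\<Sum>j\<in>{0..d}. a x j * b (f (v j)) k)"
proof -
  interpret b: frame V d w b by fact
  show ?thesis
    by (rule functional_expand[where g = "\<lambda>x. b (f x) k"])
      (use assms in \<open>auto simp: End_add End_smult End_closed\<close>)
qed

lemma End_eq_on_frame:
  assumes "f \<in> carrier (End_alg V)" "g \<in> carrier (End_alg V)"
    and "\<And>j. j \<le> d \<Longrightarrow> f (v j) = g (v j)"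
  shows "f = g"
proof (rule End_eqI[OF assms(1,2)], rule a_eqI)
  fix x k assume "x \<in> carrier V" "k \<le> d"
  then show "a (f x) k = a (g x) k"
    by (simp only: expand_End[OF frame_axioms assms(1)] expand_End[OF frame_axioms assms(2)])
      (simp add: assms(3))
qed (use End_closed[OF assms(1)] End_closed[OF assms(2)] in auto)

lemma v_nonzero: "i \<le> d \<Longrightarrow> v i \<noteq> \<zero>\<^bsub>V\<^esub>"
  using a_v[of i i] a_zero[of i] by auto

lemma linear_EndI:
  assumes "\<And>x. x \<in> carrier V \<Longrightarrow> f x \<in> carrier V"
    and "\<And>x y k. x \<in> carrier V \<Longrightarrow> y \<in> carrier V \<Longrightarrow> k \<le> d \<Longrightarrow> a (f (x \<oplus>\<^bsub>V\<^esub> y)) k = a (f x) k + a (f y) k"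
    and "\<And>c x k. x \<in> carrier V \<Longrightarrow> k \<le> d \<Longrightarrow> a (f (c \<odot>\<^bsub>V\<^esub> x)) k = c * a (f x) k"
  shows "restrict f (carrier V) \<in> carrier (End_alg V)"
  using assms by (auto simp: carrier_End intro!: a_eqI)

text \<open>Needed to match a given ordering of idempotents, and to read the split basis backwards.\<close>
lemma reindex:
  assumes "bij_betw \<pi> {0..d} {0..d}"
  shows "frame V d (\<lambda>i. v (\<pi> i)) (\<lambda>x k. a x (\<pi> k))"
proof -
  have \<pi>: "\<pi> i \<le> d" if "i \<le> d" for i using assms that by (auto simp: bij_betw_def)
  show ?thesis
  proof
    fix i k assume "i \<le> d" "k \<le> d"
    then show "a (v (\<pi> i)) (\<pi> k) = (if k = i then 1 else 0)"
      using assms by (auto simp: a_v \<pi> bij_betw_def inj_on_def)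
  next
    fix x y assume *: "x \<in> carrier V" "y \<in> carrier V" "\<And>k. k \<le> d \<Longrightarrow> a x (\<pi> k) = a y (\<pi> k)"
    have "a x k = a y k" if "k \<le> d" for k
    proof -
      have "k \<in> \<pi> ` {0..d}" using assms that by (simp add: bij_betw_def)
      then show ?thesis using *(3) by auto
    qed
    then show "x = y" using * by (intro a_eqI)
  qed (simp_all add: \<pi>)
qed

end

section \<open>Multiplicity-free maps in coordinates\<close>

text \<open>The coordinate form of a multiplicity-free map with ordered primitive idempotents: \<open>A\<close> is
  diagonal with distinct entries, and \<open>E i\<close> is the projection to the \<open>i\<close>-th coordinate.\<close>
locale eigenframe = frame V d v a for V :: "('k::field, 'v) module" and d v a +
  fixes A :: "'v \<Rightarrow> 'v" and E :: "nat \<Rightarrow> 'v \<Rightarrow> 'v" and \<theta> :: "nat \<Rightarrow> 'k"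
  assumes A_in [simp]: "A \<in> carrier (End_alg V)"
    and a_A [simp]: "x \<in> carrier V \<Longrightarrow> k \<le> d \<Longrightarrow> a (A x) k = \<theta> k * a x k"
    and E_in [simp]: "i \<le> d \<Longrightarrow> E i \<in> carrier (End_alg V)"
    and a_E [simp]: "x \<in> carrier V \<Longrightarrow> i \<le> d \<Longrightarrow> k \<le> d \<Longrightarrow> a (E i x) k = (if k = i then a x k else 0)"
    and E_ext: "E \<in> extensional {0..d}"
    and \<theta>_inj: "inj_on \<theta> {0..d}"
begin

lemma E_closed [simp]: "i \<le> d \<Longrightarrow> x \<in> carrier V \<Longrightarrow> E i x \<in> carrier V"
  by (rule End_closed[OF E_in])

lemma A_closed [simp]: "x \<in> carrier V \<Longrightarrow> A x \<in> carrier V"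
  by (rule End_closed[OF A_in])

lemma E_v: "i \<le> d \<Longrightarrow> j \<le> d \<Longrightarrow> E i (v j) = (if i = j then v j else \<zero>\<^bsub>V\<^esub>)"
  by (rule a_eqI) (auto simp: a_v)

lemma eigsp_iff: "x \<in> eigsp V A c \<longleftrightarrow> x \<in> carrier V \<and> (\<forall>k\<le>d. \<theta> k \<noteq> c \<longrightarrow> a x k = 0)"
proof -
  have "A x = c \<odot>\<^bsub>V\<^esub> x \<longleftrightarrow> (\<forall>k\<le>d. \<theta> k \<noteq> c \<longrightarrow> a x k = 0)" if x: "x \<in> carrier V"
  proof
    assume eq: "A x = c \<odot>\<^bsub>V\<^esub> x"
    show "\<forall>k\<le>d. \<theta> k \<noteq> c \<longrightarrow> a x k = 0"
    proof (intro allI impI)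
      fix k assume k: "k \<le> d" "\<theta> k \<noteq> c"
      have "a (A x) k = a (c \<odot>\<^bsub>V\<^esub> x) k" by (simp only: eq)
      then show "a x k = 0" using k x by simp
    qed
  next
    assume *: "\<forall>k\<le>d. \<theta> k \<noteq> c \<longrightarrow> a x k = 0"
    show "A x = c \<odot>\<^bsub>V\<^esub> x" using * x by (intro a_eqI) auto
  qed
  then show ?thesis by (auto simp: eigsp_def)
qed

lemma eigsp_\<theta>: "i \<le> d \<Longrightarrow> x \<in> eigsp V A (\<theta> i) \<longleftrightarrow> x \<in> carrier V \<and> (\<forall>k\<le>d. k \<noteq> i \<longrightarrow> a x k = 0)"
  using \<theta>_inj by (auto simp: eigsp_iff inj_on_def)

lemma v_eigsp: "i \<le> d \<Longrightarrow> v i \<in> eigsp V A (\<theta> i)"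
  by (simp add: eigsp_\<theta> a_v)

lemma eigvals_eq: "eigvals V A = \<theta> ` {0..d}"
proof (intro Set.set_eqI iffI)
  fix c assume "c \<in> eigvals V A"
  then obtain x where x: "x \<in> eigsp V A c" "x \<noteq> \<zero>\<^bsub>V\<^esub>" by (auto simp: eigvals_def)
  have "\<exists>k\<le>d. \<theta> k = c"
  proof (rule ccontr)
    assume "\<not> (\<exists>k\<le>d. \<theta> k = c)"
    then have "x = \<zero>\<^bsub>V\<^esub>" using x(1) by (intro a_eqI) (auto simp: eigsp_iff)
    with x(2) show False by simp
  qed
  then show "c \<in> \<theta> ` {0..d}" by auto
next
  fix c assume "c \<in> \<theta> ` {0..d}"
  then obtain i where "i \<le> d" "c = \<theta> i" by auto
  then show "c \<in> eigvals V A" using v_eigsp[of i] v_nonzero[of i] by (auto simp: eigvals_def)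
qed

lemma has_dim_eigsp:
  assumes i: "i \<le> d"
  shows "has_dim (V\<lparr>carrier := eigsp V A (\<theta> i)\<rparr>) 1"
proof -
  let ?W = "V\<lparr>carrier := eigsp V A (\<theta> i)\<rparr>"
  have "submodule class_ring (eigsp V A (\<theta> i)) V"
    by unfold_locales (use i in \<open>auto simp: eigsp_\<theta> class_ring_simps\<close>)
  then have "subspace class_ring (eigsp V A (\<theta> i)) V"
    using vectorspace_axioms by (simp add: subspace_def)
  then interpret W: vspace ?W
    unfolding vspace_def by (rule subspace_is_vs)
  interpret W: frame ?W 0 "\<lambda>_. v i" "\<lambda>x _. a x i"
  proof
    fix x y assume "x \<in> carrier ?W" "y \<in> carrier ?W" "\<And>k. k \<le> (0::nat) \<Longrightarrow> a x i = a y i"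
    then show "x = y" using i by (intro a_eqI) (auto simp: eigsp_\<theta>, metis)
  qed (use i v_eigsp in \<open>auto simp: eigsp_\<theta> a_v\<close>)
  show ?thesis using W.has_dim_frame by simp
qed

lemma mult_free: "mult_free V A"
proof -
  have "diagonalizable V A"
    unfolding diagonalizable_def using basis_frame(1) v_eigsp by fastforce
  then show ?thesis using has_dim_eigsp by (auto simp: mult_free_def eigvals_eq)
qed

lemma prim_idem_E:
  assumes "i \<le> d"
  shows "prim_idem V A (\<theta> i) (E i)"
  unfolding prim_idem_def eigvals_eq
proof (intro conjI ballI impI)
  fix x assume "x \<in> eigsp V A (\<theta> i)"
  then show "E i x = x" using assms by (intro a_eqI) (auto simp: eigsp_\<theta>)
next
  fix c x assume "c \<in> \<theta> ` {0..d}" "c \<noteq> \<theta> i" "x \<in> eigsp V A c"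
  then show "E i x = \<zero>\<^bsub>V\<^esub>" using assms by (intro a_eqI) (auto simp: eigsp_\<theta>)
qed (use assms in auto)

lemma prim_idem_unique:
  assumes "prim_idem V A c e"
  obtains i where "i \<le> d" "c = \<theta> i" "e = E i"
proof -
  have c: "c \<in> \<theta> ` {0..d}" and e: "e \<in> carrier (End_alg V)"
    using assms by (auto simp: prim_idem_def eigvals_eq)
  from c obtain i where i: "i \<le> d" "c = \<theta> i" by auto
  have "e = E i"
  proof (rule End_eq_on_frame[OF e])
    fix j assume j: "j \<le> d"
    have "e (v j) = (if j = i then v j else \<zero>\<^bsub>V\<^esub>)"
    proof (cases "j = i")
      case True
      then show ?thesis using assms v_eigsp[OF j] i by (simp add: prim_idem_def)
    next
      case False
      then have "\<theta> j \<noteq> \<theta> i" using \<theta>_inj i j by (auto simp: inj_on_def)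
      moreover have "\<theta> j \<in> eigvals V A" using j by (simp add: eigvals_eq)
      ultimately show ?thesis using assms v_eigsp[OF j] i False by (simp add: prim_idem_def)
    qed
    then show "e (v j) = E i (v j)" using i j by (auto simp: E_v)
  qed (use i in simp)
  then show ?thesis using that i by blast
qed

lemma E_inj: "inj_on E {0..d}"
proof (rule inj_onI)
  fix i j assume *: "i \<in> {0..d}" "j \<in> {0..d}" "E i = E j"
  then have "E j (v i) = v i" using E_v[of i i] by simp
  then show "i = j" using * v_nonzero[of i] by (auto simp: E_v split: if_splits)
qed

lemma idems_eq: "{e. \<exists>c. prim_idem V A c e} = E ` {0..d}"
proof (intro Set.set_eqI iffI)
  fix e assume "e \<in> {e. \<exists>c. prim_idem V A c e}"
  then show "e \<in> E ` {0..d}" by (auto elim: prim_idem_unique)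
next
  fix e assume "e \<in> E ` {0..d}"
  then obtain i where "i \<le> d" "e = E i" by auto
  then show "e \<in> {e. \<exists>c. prim_idem V A c e}" using prim_idem_E[of i] by blast
qed

lemma idem_ordering: "idem_ordering d V A E"
  unfolding idem_ordering_def idems_eq using E_ext E_inj by (simp add: bij_betw_def)

lemma the_eigenvalue: "i \<le> d \<Longrightarrow> (THE c. prim_idem V A c (E i)) = \<theta> i"
  using inj_onD[OF E_inj, of i] by (intro the_equality) (fastforce simp: prim_idem_E elim!: prim_idem_unique)+

lemma sum_spaces_E:
  assumes "i \<le> d"
  shows "sum_spaces V (\<lambda>j. E j ` carrier V) {0..i} = {x \<in> carrier V. \<forall>k\<le>d. i < k \<longrightarrow> a x k = 0}"
    (is "?L = ?R")
proof (intro Set.set_eqI iffI)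
  fix x assume "x \<in> ?L"
  then obtain w where x: "x = finsum V w {0..i}" and w: "\<forall>j\<in>{0..i}. w j \<in> E j ` carrier V"
    by (auto simp: sum_spaces_def)
  have w': "w \<in> {0..i} \<rightarrow> carrier V" using w assms by fastforce
  have "a x k = 0" if "k \<le> d" "i < k" for k
  proof -
    have "a x k = (\<Sum>j\<in>{0..i}. a (w j) k)"
      unfolding x by (rule functional_finsum[where g = "\<lambda>x. a x k"]) (use that w' in auto)
    also have "\<dots> = 0"
    proof (rule sum.neutral, rule)
      fix j assume j: "j \<in> {0..i}"
      then obtain y where "y \<in> carrier V" "w j = E j y" using w by blast
      then show "a (w j) k = 0" using j that by auto
    qed
    finally show ?thesis .
  qed
  then show "x \<in> ?R" using w' by (auto simp: x intro!: finsum_closed)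
next
  fix x assume x: "x \<in> ?R"
  have "x = finsum V (\<lambda>j. E j x) {0..i}"
  proof (rule a_eqI)
    fix k assume k: "k \<le> d"
    have "a (finsum V (\<lambda>j. E j x) {0..i}) k = (\<Sum>j\<in>{0..i}. a (E j x) k)"
      by (rule functional_finsum[where g = "\<lambda>x. a x k"]) (use k x assms in auto)
    also have "\<dots> = (\<Sum>j\<in>{0..i}. if j = k then a x k else 0)"
      using k x assms by (intro sum.cong) auto
    also have "\<dots> = a x k" using x k by auto
    finally show "a x k = a (finsum V (\<lambda>j. E j x) {0..i}) k" by simp
  qed (use x assms in \<open>auto intro!: finsum_closed\<close>)
  then show "x \<in> ?L" using x unfolding sum_spaces_def by blast
qed

text \<open>Since \<open>E i\<close> and \<open>E j\<close> have rank one, the product \<open>E i f E j\<close> carries a single matrix entry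
  of \<open>f\<close>.\<close>
lemma E_f_E_zero_iff:
  assumes f: "f \<in> carrier (End_alg V)" and ij: "i \<le> d" "j \<le> d"
  shows "E i \<otimes>\<^bsub>End_alg V\<^esub> f \<otimes>\<^bsub>End_alg V\<^esub> E j = \<zero>\<^bsub>End_alg V\<^esub> \<longleftrightarrow> a (f (v j)) i = 0" (is "?L = _ \<longleftrightarrow> _")
proof
  assume "?L = \<zero>\<^bsub>End_alg V\<^esub>"
  then have "?L (v j) = \<zero>\<^bsub>V\<^esub>" using ij by (simp add: End_apply)
  moreover have "?L (v j) = E i (f (v j))" using ij by (simp add: End_apply E_v)
  ultimately have "a (E i (f (v j))) i = 0" using ij by simp
  then show "a (f (v j)) i = 0" using ij f End_closed[OF f] by simp
next
  assume *: "a (f (v j)) i = 0"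
  show "?L = \<zero>\<^bsub>End_alg V\<^esub>"
  proof (rule End_eq_on_frame)
    fix k assume k: "k \<le> d"
    have "?L (v k) = E i (f (E j (v k)))" using ij k by (simp add: End_apply)
    also have "\<dots> = \<zero>\<^bsub>V\<^esub>"
      using * ij k f End_closed[OF f] End_smult[OF f, of "\<zero>\<^bsub>V\<^esub>" 0]
      by (intro a_eqI) (auto simp: E_v)
    finally show "?L (v k) = \<zero>\<^bsub>End_alg V\<^esub> (v k)" using k by (simp add: End_apply)
  qed (use ij f in \<open>auto simp: End_alg_closed\<close>)
qed

end

context frame begin

lemma eigenframe_of_eigenvectors:
  assumes f: "f \<in> carrier (End_alg V)" and eig: "\<And>i. i \<le> d \<Longrightarrow> f (v i) = c i \<odot>\<^bsub>V\<^esub> v i"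
    and inj: "inj_on c {0..d}"
  shows "\<exists>P. eigenframe V d v a f P c"
proof
  let ?P = "\<lambda>i\<in>{0..d}. \<lambda>x\<in>carrier V. a x i \<odot>\<^bsub>V\<^esub> v i"
  show "eigenframe V d v a f ?P c"
  proof
    fix x k assume x: "x \<in> carrier V" "k \<le> d"
    have "a (f x) k = (\<Sum>j\<in>{0..d}. if k = j then c j * a x j else 0)"
      unfolding expand_End[OF frame_axioms f x] using x
      by (intro sum.cong) (auto simp: eig a_v)
    also have "\<dots> = c k * a x k" using x by simp
    finally show "a (f x) k = c k * a x k" .
  next
    fix i assume i: "i \<le> d"
    have "?P i = restrict (\<lambda>x. a x i \<odot>\<^bsub>V\<^esub> v i) (carrier V)" using i by simp
    then show "?P i \<in> carrier (End_alg V)"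
      using i by (auto intro!: linear_EndI simp: distrib_right mult.assoc)
  next
    fix x i k assume "x \<in> carrier V" "i \<le> d" "k \<le> d"
    then show "a (?P i x) k = (if k = i then a x k else 0)" by (simp add: a_v)
  qed (use f inj in auto)
qed

end

text \<open>One-dimensional eigenspaces make the eigenvalues of the members of an eigenbasis distinct, so
  the primitive idempotents are exactly the coordinate projections of that basis. The given ordering
  of the idempotents then prescribes the permutation \<open>\<pi>\<close> by which the basis has to be reindexed.\<close>
lemma eigenframe_exists:
  assumes dim: "has_dim V (d + 1)" and mf: "mult_free V A" and ord: "idem_ordering d V A E"
  shows "\<exists>v a \<theta>. eigenframe V d v a A E \<theta>"
proof -
  interpret vspace V using dim by (simp add: has_dim_def vspace_def)
  have A: "A \<in> carrier (End_alg V)" using mf by (simp add: mult_free_def)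
  obtain B where B: "basis B" and eig: "\<forall>b\<in>B. \<exists>c. b \<in> eigsp V A c"
    using mf by (auto simp: mult_free_def diagonalizable_def)
  have "fin_dim" and dimV: "dim = d + 1" using dim by (auto simp: has_dim_def)
  then have fB: "finite B" using B fin_dim_li_fin by (auto simp: basis_def)
  then have "card B = d + 1" using dim_basis B dimV by simp
  then obtain w where w: "bij_betw w {0..d} B"
    using ex_bij_betw_nat_finite[OF fB] atLeastLessThanSuc_atLeastAtMost by auto
  then obtain b where "frame V d w b" using frame_of_basis[OF B] by blast
  then interpret F: frame V d w b .
  have "\<exists>c. A (w i) = c \<odot>\<^bsub>V\<^esub> w i" if "i \<le> d" for i
    using eig w that by (fastforce simp: eigsp_def bij_betw_def)
  then obtain c where c: "\<And>i. i \<le> d \<Longrightarrow> A (w i) = c i \<odot>\<^bsub>V\<^esub> w i" by metis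
  have "inj_on c {0..d}"
  proof (rule inj_onI, rule ccontr)
    fix i j assume *: "i \<in> {0..d}" "j \<in> {0..d}" "c i = c j" "i \<noteq> j"
    let ?W = "V\<lparr>carrier := eigsp V A (c i)\<rparr>"
    have wi: "w i \<in> eigsp V A (c i)" and wj: "w j \<in> eigsp V A (c i)"
      using * c by (auto simp: eigsp_def)
    then have "c i \<in> eigvals V A" using F.v_nonzero[of i] * by (auto simp: eigvals_def)
    then have "has_dim ?W (0 + 1)" using mf by (simp add: mult_free_def)
    then obtain v' a' where "frame ?W 0 v' a'" using frame_exists by blast
    then interpret W: frame ?W 0 v' a' .
    \<comment> \<open>Both vectors lie on the same line, so they are proportional, against their independence.\<close>
    let ?x = "a' (w i) 0" and ?y = "a' (w j) 0"
    have "?y \<odot>\<^bsub>V\<^esub> w i = ?x \<odot>\<^bsub>V\<^esub> w j"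
      using W.a_eqI[of "?y \<odot>\<^bsub>V\<^esub> w i" "?x \<odot>\<^bsub>V\<^esub> w j"] W.smult_in[of "w i" ?y] W.smult_in[of "w j" ?x]
        W.a_smult[of "w i" 0 ?y] W.a_smult[of "w j" 0 ?x] wi wj by (simp add: mult.commute)
    then have "b (?y \<odot>\<^bsub>V\<^esub> w i) i = b (?x \<odot>\<^bsub>V\<^esub> w j) i" by simp
    then have y: "?y = 0" using * by (simp add: F.a_v)
    have "w j = \<zero>\<^bsub>V\<^esub>"
      using W.a_eqI[of "w j" "\<zero>\<^bsub>V\<^esub>"] W.a_zero[of 0] W.zero_closed wj y by simp
    then show False using F.v_nonzero[of j] * by simp
  qed
  obtain P where "eigenframe V d w b A P c"
    using F.eigenframe_of_eigenvectors[OF A c \<open>inj_on c {0..d}\<close>] by blast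
  then interpret G: eigenframe V d w b A P c .
  have bijE: "bij_betw E {0..d} (P ` {0..d})" and extE: "E \<in> extensional {0..d}"
    using ord by (auto simp: idem_ordering_def G.idems_eq)
  define \<pi> where "\<pi> = the_inv_into {0..d} P \<circ> E"
  have \<pi>: "bij_betw \<pi> {0..d} {0..d}"
    unfolding \<pi>_def using bijE G.E_inj
    by (intro bij_betw_trans[OF bijE] bij_betw_the_inv_into) (simp add: bij_betw_def)
  have \<pi>_le: "\<pi> i \<le> d" if "i \<le> d" for i using \<pi> that by (auto simp: bij_betw_def)
  have E\<pi>: "E i = P (\<pi> i)" if "i \<le> d" for i
  proof -
    have "E i \<in> P ` {0..d}" using bijE that by (auto simp: bij_betw_def)
    then show ?thesis by (simp add: \<pi>_def f_the_inv_into_f[OF G.E_inj])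
  qed
  interpret H: frame V d "\<lambda>i. w (\<pi> i)" "\<lambda>x k. b x (\<pi> k)" by (rule F.reindex[OF \<pi>])
  have "eigenframe V d (\<lambda>i. w (\<pi> i)) (\<lambda>x k. b x (\<pi> k)) A E (\<lambda>i. c (\<pi> i))"
  proof
    fix x i k assume "x \<in> carrier V" "i \<le> d" "k \<le> d"
    then show "b (E i x) (\<pi> k) = (if k = i then b x (\<pi> k) else 0)"
      using \<pi> by (auto simp: E\<pi> \<pi>_le bij_betw_def inj_on_def)
  next
    show "inj_on (\<lambda>i. c (\<pi> i)) {0..d}"
      using comp_inj_on[of \<pi> "{0..d}" c] \<pi> \<open>inj_on c {0..d}\<close> by (simp add: bij_betw_def o_def)
  qed (use A extE in \<open>auto simp: E\<pi> \<pi>_le\<close>)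
  then show ?thesis by blast
qed

section \<open>Flags and triangular changes of basis\<close>

text \<open>For the coordinates \<open>a\<close> of a basis \<open>v\<close>, this says that \<open>x\<close> lies in the span of
  \<open>v 0, \<dots>, v (i - 1)\<close>: membership in a step of the flag of the basis.\<close>
definition vanishes_from :: "nat \<Rightarrow> ('v \<Rightarrow> nat \<Rightarrow> 'k::zero) \<Rightarrow> nat \<Rightarrow> 'v \<Rightarrow> bool" where
  "vanishes_from d a i x \<longleftrightarrow> (\<forall>k. i \<le> k \<longrightarrow> k \<le> d \<longrightarrow> a x k = 0)"

definition same_flag :: "('k::field, 'v) module \<Rightarrow> nat \<Rightarrow> ('v \<Rightarrow> nat \<Rightarrow> 'k) \<Rightarrow> ('v \<Rightarrow> nat \<Rightarrow> 'k) \<Rightarrow> bool" where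
  "same_flag V d a b \<longleftrightarrow> (\<forall>x\<in>carrier V. \<forall>i. vanishes_from d a i x \<longleftrightarrow> vanishes_from d b i x)"

text \<open>In matrix terms, \<open>f\<close> is upper Hessenberg with non-zero subdiagonal. The formulation by
  vectors instead of matrix entries depends only on the flag, which makes its invariance under
  triangular changes of basis immediate.\<close>
definition raises :: "('k::field, 'v) module \<Rightarrow> nat \<Rightarrow> ('v \<Rightarrow> nat \<Rightarrow> 'k) \<Rightarrow> ('v \<Rightarrow> 'v) \<Rightarrow> bool" where
  "raises V d a f \<longleftrightarrow> (\<forall>x\<in>carrier V. \<forall>i. vanishes_from d a (Suc i) x \<longrightarrow>
     vanishes_from d a (Suc (Suc i)) (f x) \<and> (i < d \<longrightarrow> a x i \<noteq> 0 \<longrightarrow> a (f x) (Suc i) \<noteq> 0))"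

lemma vanishes_fromD: "vanishes_from d a i x \<Longrightarrow> i \<le> k \<Longrightarrow> k \<le> d \<Longrightarrow> a x k = 0"
  by (auto simp: vanishes_from_def)

lemma vanishes_from_beyond: "d < i \<Longrightarrow> vanishes_from d a i x"
  by (auto simp: vanishes_from_def)

lemma vanishes_from_Suc:
  "i \<le> d \<Longrightarrow> vanishes_from d a i x \<longleftrightarrow> a x i = 0 \<and> vanishes_from d a (Suc i) x"
  by (auto simp: vanishes_from_def le_Suc_eq dest: le_neq_implies_less Suc_leI)

lemma same_flagD: "same_flag V d a b \<Longrightarrow> x \<in> carrier V \<Longrightarrow> vanishes_from d a i x \<longleftrightarrow> vanishes_from d b i x"
  by (simp add: same_flag_def)

lemma same_flag_sym: "same_flag V d a b \<Longrightarrow> same_flag V d b a"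
  by (simp add: same_flag_def)

lemma same_flag_lead:
  assumes "same_flag V d a b" "x \<in> carrier V" "i \<le> d" "vanishes_from d a (Suc i) x"
  shows "a x i = 0 \<longleftrightarrow> b x i = 0"
  using assms by (metis same_flagD vanishes_from_Suc)

lemma raises_same_flag:
  assumes flag: "same_flag V d a b" and r: "raises V d a f" and f: "f \<in> carrier (End_alg V)"
  shows "raises V d b f"
  unfolding raises_def
proof (intro ballI allI impI)
  fix x i assume x: "x \<in> carrier V" and van: "vanishes_from d b (Suc i) x"
  have fx: "f x \<in> carrier V" using f x by (rule End_closed)
  have van': "vanishes_from d a (Suc i) x" using van same_flagD[OF flag x] by simp
  then have 1: "vanishes_from d a (Suc (Suc i)) (f x)"
    and 2: "i < d \<Longrightarrow> a x i \<noteq> 0 \<Longrightarrow> a (f x) (Suc i) \<noteq> 0"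
    using r x by (auto simp: raises_def)
  have "i < d \<Longrightarrow> b x i \<noteq> 0 \<Longrightarrow> b (f x) (Suc i) \<noteq> 0"
    using 2 same_flag_lead[OF flag x _ van'] same_flag_lead[OF flag fx _ 1] by simp
  then show "vanishes_from d b (Suc (Suc i)) (f x) \<and> (i < d \<longrightarrow> b x i \<noteq> 0 \<longrightarrow> b (f x) (Suc i) \<noteq> 0)"
    using 1 same_flagD[OF flag fx] by simp
qed

context frame begin

lemma vanishes_from_0: "x \<in> carrier V \<Longrightarrow> vanishes_from d a 0 x \<Longrightarrow> x = \<zero>\<^bsub>V\<^esub>"
  by (rule a_eqI) (auto simp: vanishes_from_def)

lemma vanishes_from_v: "i < j \<Longrightarrow> i \<le> d \<Longrightarrow> vanishes_from d a j (v i)"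
  by (auto simp: vanishes_from_def a_v)

lemma raises_iff:
  assumes f: "f \<in> carrier (End_alg V)"
  shows "raises V d a f \<longleftrightarrow> (\<forall>i\<le>d. \<forall>j\<le>d. (i > j + 1 \<longrightarrow> a (f (v j)) i = 0) \<and> (i = j + 1 \<longrightarrow> a (f (v j)) i \<noteq> 0))"
    (is "_ \<longleftrightarrow> ?R")
proof
  assume r: "raises V d a f"
  show ?R
  proof (intro allI impI)
    fix i j assume ij: "i \<le> d" "j \<le> d"
    show "(i > j + 1 \<longrightarrow> a (f (v j)) i = 0) \<and> (i = j + 1 \<longrightarrow> a (f (v j)) i \<noteq> 0)"
      using r v_in[OF ij(2)] vanishes_from_v[of j "Suc j"] ij a_v[of j j]
      by (auto simp: raises_def vanishes_from_def)
  qed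
next
  assume R: ?R
  show "raises V d a f" unfolding raises_def
  proof (intro ballI allI impI conjI)
    fix x i assume x: "x \<in> carrier V" and van: "vanishes_from d a (Suc i) x"
    show "vanishes_from d a (Suc (Suc i)) (f x)" unfolding vanishes_from_def
    proof (intro allI impI)
      fix k assume k: "Suc (Suc i) \<le> k" "k \<le> d"
      show "a (f x) k = 0" unfolding expand_End[OF frame_axioms f x k(2)]
      proof (rule sum.neutral, rule)
        fix j assume "j \<in> {0..d}"
        then show "a x j * a (f (v j)) k = 0"
          using vanishes_fromD[OF van, of j] R k by (cases "Suc i \<le> j") auto
      qed
    qed
    assume i: "i < d" "a x i \<noteq> 0"
    have "a (f x) (Suc i) = (\<Sum>j\<in>{0..d}. if j = i then a x i * a (f (v i)) (Suc i) else 0)"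
      unfolding expand_End[OF frame_axioms f x Suc_leI[OF i(1)]]
    proof (rule sum.cong[OF refl])
      fix j assume "j \<in> {0..d}"
      then show "a x j * a (f (v j)) (Suc i) = (if j = i then a x i * a (f (v i)) (Suc i) else 0)"
        using vanishes_fromD[OF van, of j] R i by (cases "Suc i \<le> j") auto
    qed
    moreover have "a (f (v i)) (Suc i) \<noteq> 0" using R i by (metis Suc_eq_plus1 Suc_leI less_imp_le)
    ultimately show "a (f x) (Suc i) \<noteq> 0" using i by simp
  qed
qed

text \<open>A vector and its expansion in the \<open>w i\<close> have proportional leading coordinates, so a downward
  induction removes the top coordinates on both sides simultaneously.\<close>
lemma triangular_same_flag:
  assumes "frame V d w b"
    and tri: "\<And>i. i \<le> d \<Longrightarrow> vanishes_from d a (Suc i) (w i)"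
    and lead: "\<And>i. i \<le> d \<Longrightarrow> a (w i) i \<noteq> 0"
  shows "same_flag V d a b"
  unfolding same_flag_def
proof (intro ballI allI)
  fix x i assume x: "x \<in> carrier V"
  interpret b: frame V d w b by fact
  have ex: "a x k = (\<Sum>j\<in>{0..d}. b x j * a (w j) k)" if "k \<le> d" for k
    by (rule b.expand[OF frame_axioms x that])
  have van: "vanishes_from d a i x" if "vanishes_from d b i x" for i
    unfolding vanishes_from_def
  proof (intro allI impI)
    fix k assume k: "i \<le> k" "k \<le> d"
    show "a x k = 0" unfolding ex[OF k(2)]
    proof (rule sum.neutral, rule)
      fix j assume "j \<in> {0..d}"
      then show "b x j * a (w j) k = 0"
        using vanishes_fromD[OF that, of j] vanishes_fromD[OF tri[of j], of k] k by (cases "i \<le> j") auto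
    qed
  qed
  have lead': "a x i = b x i * a (w i) i" if "vanishes_from d b (Suc i) x" "i \<le> d" for i
  proof -
    have "a x i = (\<Sum>j\<in>{0..d}. if j = i then b x i * a (w i) i else 0)"
      unfolding ex[OF that(2)]
    proof (rule sum.cong[OF refl])
      fix j assume "j \<in> {0..d}"
      then show "b x j * a (w j) i = (if j = i then b x i * a (w i) i else 0)"
        using vanishes_fromD[OF that(1), of j] vanishes_fromD[OF tri[of j], of i] that
        by (cases j i rule: linorder_cases) auto
    qed
    then show ?thesis using that by simp
  qed
  have "vanishes_from d b i x" if "vanishes_from d a i x"
    using that
  proof (induction "Suc d - i" arbitrary: i)
    case 0
    then show ?case by (simp add: vanishes_from_beyond)
  next
    case (Suc n)
    then have i: "i \<le> d" by simp
    have "vanishes_from d a (Suc i) x" using Suc.prems i by (simp add: vanishes_from_Suc)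
    moreover have "n = Suc d - Suc i" using Suc.hyps(2) by simp
    ultimately have "vanishes_from d b (Suc i) x" using Suc.hyps(1) by blast
    moreover have "a x i = 0" using Suc.prems i by (simp add: vanishes_from_Suc)
    ultimately show ?case using lead' lead i by (simp add: vanishes_from_Suc)
  qed
  then show "vanishes_from d a i x \<longleftrightarrow> vanishes_from d b i x" using van by blast
qed

text \<open>The leading coordinates show the \<open>w i\<close> to be independent, and there are as many of them as
  the dimension.\<close>
lemma triangular_frame:
  assumes w: "\<And>i. i \<le> d \<Longrightarrow> w i \<in> carrier V"
    and tri: "\<And>i. i \<le> d \<Longrightarrow> vanishes_from d a (Suc i) (w i)"
    and lead: "\<And>i. i \<le> d \<Longrightarrow> a (w i) i \<noteq> 0"
  shows "\<exists>b. frame V d w b \<and> same_flag V d a b"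
proof -
  let ?B = "w ` {0..d}"
  have B: "finite ?B" "?B \<subseteq> carrier V" using w by auto
  have inj: "inj_on w {0..d}"
  proof (rule linorder_inj_onI)
    fix i j assume "i < j" "i \<in> {0..d}" "j \<in> {0..d}"
    then show "w i \<noteq> w j" using lead[of j] vanishes_fromD[OF tri[of i], of j] by auto
  qed auto
  have "lin_indpt ?B"
  proof (rule finite_lin_indpt2[OF B])
    fix c assume "lincomb c ?B = \<zero>\<^bsub>V\<^esub>"
    then have z: "finsum V (\<lambda>i. c (w i) \<odot>\<^bsub>V\<^esub> w i) {0..d} = \<zero>\<^bsub>V\<^esub>"
      unfolding lincomb_def using inj w by (subst (asm) finsum_reindex) auto
    have ex: "(\<Sum>i\<in>{0..d}. c (w i) * a (w i) k) = 0" if k: "k \<le> d" for k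
    proof -
      have "a (finsum V (\<lambda>i. c (w i) \<odot>\<^bsub>V\<^esub> w i) {0..d}) k = (\<Sum>i\<in>{0..d}. a (c (w i) \<odot>\<^bsub>V\<^esub> w i) k)"
        by (rule functional_finsum[where g = "\<lambda>x. a x k"]) (use k w in auto)
      also have "\<dots> = (\<Sum>i\<in>{0..d}. c (w i) * a (w i) k)" using k w by (intro sum.cong) auto
      finally show ?thesis using z k by simp
    qed
    have zeros: "\<forall>j\<le>d. i \<le> j \<longrightarrow> c (w j) = 0" for i
    proof (induction "Suc d - i" arbitrary: i)
      case 0
      then show ?case by auto
    next
      case (Suc n)
      then have i: "i \<le> d" and IH: "\<forall>j\<le>d. Suc i \<le> j \<longrightarrow> c (w j) = 0"
        using Suc.hyps(1)[of "Suc i"] by simp_all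
      have "(\<Sum>j\<in>{0..d}. c (w j) * a (w j) i) = (\<Sum>j\<in>{0..d}. if j = i then c (w i) * a (w i) i else 0)"
      proof (rule sum.cong[OF refl])
        fix j assume "j \<in> {0..d}"
        then show "c (w j) * a (w j) i = (if j = i then c (w i) * a (w i) i else 0)"
          using IH vanishes_fromD[OF tri[of j], of i] i by (cases j i rule: linorder_cases) auto
      qed
      then have "c (w i) = 0" using ex[OF i] i lead[OF i] by simp
      then show ?case using IH by (auto simp: le_eq_less_or_eq Suc_le_eq)
    qed
    show "\<forall>x\<in>?B. c x = \<zero>\<^bsub>class_ring\<^esub>" using zeros[of 0] by (auto simp: class_ring_simps)
  qed
  moreover have "fin_dim" "dim \<le> card ?B"
    using has_dim_frame inj by (auto simp: has_dim_def card_image)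
  ultimately have "basis ?B" using dim_li_is_basis B by blast
  then obtain b where "frame V d w b"
    using frame_of_basis inj by (meson inj_on_imp_bij_betw)
  then show ?thesis using triangular_same_flag[OF _ tri lead] by blast
qed

end

section \<open>Products of shifted maps and triangular diagonalization\<close>

text \<open>The vector \<open>(f - t (n - 1)) \<dots> (f - t 0) x\<close>. As \<^const>\<open>End_alg\<close> is itself a module over the
  field, the definition also applies to the map multiplying by a fixed endomorphism.\<close>
primrec krylov :: "('k::field, 'v) module \<Rightarrow> ('v \<Rightarrow> 'v) \<Rightarrow> (nat \<Rightarrow> 'k) \<Rightarrow> 'v \<Rightarrow> nat \<Rightarrow> 'v" where
  "krylov V f t x 0 = x"
| "krylov V f t x (Suc n) = f (krylov V f t x n) \<oplus>\<^bsub>V\<^esub> (- t n) \<odot>\<^bsub>V\<^esub> krylov V f t x n"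

context frame begin

lemma krylov_in [simp]:
  "f \<in> carrier (End_alg V) \<Longrightarrow> x \<in> carrier V \<Longrightarrow> krylov V f t x n \<in> carrier V"
  by (induction n) (auto simp: End_closed)

lemma krylov_shift:
  assumes f: "f \<in> carrier (End_alg V)" and x: "x \<in> carrier V"
  shows "krylov V f t (f x \<oplus>\<^bsub>V\<^esub> (- c) \<odot>\<^bsub>V\<^esub> x) n =
    f (krylov V f t x n) \<oplus>\<^bsub>V\<^esub> (- c) \<odot>\<^bsub>V\<^esub> krylov V f t x n"
proof (induction n)
  case (Suc n)
  show ?case unfolding krylov.simps(2) Suc
    by (rule a_eqI) (use f x in \<open>auto simp: End_closed End_add End_smult algebra_simps\<close>)
qed simp

text \<open>The eigenvector for the eigenvalue \<open>t i\<close> is \<open>w i = (f - t 0) \<dots> (f - t (i - 1)) (v i)\<close>. Its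
  \<open>i\<close>-th coordinate is the product of the differences \<open>t i - t j\<close> for \<open>j < i\<close>, so the \<open>w i\<close> are
  triangular. It is an eigenvector because \<open>f - t i\<close> commutes past the product, takes \<open>v i\<close> one step
  down in the flag, and then each factor \<open>f - t j\<close>, in the order \<open>j = i - 1, \<dots>, 0\<close>, goes down a
  further step.\<close>
lemma triangular_diagonalize:
  assumes f: "f \<in> carrier (End_alg V)"
    and tri: "\<And>i. i \<le> d \<Longrightarrow> vanishes_from d a (Suc i) (f (v i))"
    and diag: "\<And>i. i \<le> d \<Longrightarrow> a (f (v i)) i = t i"
    and inj: "inj_on t {0..d}"
  shows "\<exists>w b E. eigenframe V d w b f E t \<and> same_flag V d a b"
proof -
  have lead: "a (f x) i = t i * a x i" and van: "vanishes_from d a (Suc i) (f x)"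
    if x: "x \<in> carrier V" and i: "i \<le> d" and "vanishes_from d a (Suc i) x" for x i
  proof -
    have "a (f x) i = (\<Sum>j\<in>{0..d}. if j = i then t i * a x i else 0)"
      unfolding expand_End[OF frame_axioms f x i]
    proof (rule sum.cong[OF refl])
      fix j assume "j \<in> {0..d}"
      then show "a x j * a (f (v j)) i = (if j = i then t i * a x i else 0)"
        using vanishes_fromD[OF that(3), of j] vanishes_fromD[OF tri[of j], of i] diag[of i] i
        by (cases j i rule: linorder_cases) auto
    qed
    then show "a (f x) i = t i * a x i" using i by simp
    show "vanishes_from d a (Suc i) (f x)" unfolding vanishes_from_def
    proof (intro allI impI)
      fix k assume k: "Suc i \<le> k" "k \<le> d"
      show "a (f x) k = 0" unfolding expand_End[OF frame_axioms f x k(2)]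
      proof (rule sum.neutral, rule)
        fix j assume "j \<in> {0..d}"
        then show "a x j * a (f (v j)) k = 0"
          using vanishes_fromD[OF that(3), of j] vanishes_fromD[OF tri[of j], of k] k
          by (cases "Suc i \<le> j") auto
      qed
    qed
  qed
  \<comment> \<open>The factor applied first has to be \<open>f - t (i - 1)\<close>, so the sequence of shifts is reversed.\<close>
  define w where "w i = krylov V f (\<lambda>j. t (i - 1 - j)) (v i) i" for i
  have w_in: "w i \<in> carrier V" if "i \<le> d" for i using f that by (simp add: w_def)
  have krylov_lead: "vanishes_from d a (Suc i) (krylov V f s (v i) n)
      \<and> a (krylov V f s (v i) n) i = (\<Prod>j<n. t i - s j)" if i: "i \<le> d" for i n s
  proof (induction n)
    case 0
    show ?case using i by (simp add: vanishes_from_v a_v)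
  next
    case (Suc n)
    let ?y = "krylov V f s (v i) n"
    have "a (f ?y) i = t i * a ?y i" "vanishes_from d a (Suc i) (f ?y)"
      using Suc lead van f i by auto
    then show ?case using Suc i f by (auto simp: vanishes_from_def End_closed algebra_simps)
  qed
  have krylov_kill: "vanishes_from d a (i - n) (krylov V f (\<lambda>j. t (i - 1 - j)) y n)"
    if y: "y \<in> carrier V" "vanishes_from d a i y" and i: "i \<le> d" and n: "n \<le> i" for i y n
    using n
  proof (induction n)
    case 0
    then show ?case using y by simp
  next
    case (Suc n)
    let ?y = "krylov V f (\<lambda>j. t (i - 1 - j)) y n"
    let ?m = "i - Suc n"
    have m: "Suc ?m = i - n" "?m \<le> d" "i - 1 - n = ?m" using Suc.prems i by auto
    have van': "vanishes_from d a (Suc ?m) ?y" using Suc m by simp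
    have yV: "?y \<in> carrier V" using f y by simp
    have "a (f ?y) ?m = t ?m * a ?y ?m" "vanishes_from d a (Suc ?m) (f ?y)"
      using lead[OF yV m(2) van'] van[OF yV m(2) van'] by auto
    then have "vanishes_from d a (Suc ?m) (f ?y \<oplus>\<^bsub>V\<^esub> (- t ?m) \<odot>\<^bsub>V\<^esub> ?y)"
      and "a (f ?y \<oplus>\<^bsub>V\<^esub> (- t ?m) \<odot>\<^bsub>V\<^esub> ?y) ?m = 0"
      using van' yV f m(2) by (auto simp: vanishes_from_def End_closed)
    then show ?case using m by (simp add: vanishes_from_Suc)
  qed
  have eig: "f (w i) = t i \<odot>\<^bsub>V\<^esub> w i" if i: "i \<le> d" for i
  proof -
    let ?y = "f (v i) \<oplus>\<^bsub>V\<^esub> (- t i) \<odot>\<^bsub>V\<^esub> v i"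
    have y: "?y \<in> carrier V" using f i by (simp add: End_closed)
    have "a (f (v i)) k = 0" if "i < k" "k \<le> d" for k
      using vanishes_fromD[OF tri[OF i], of k] that by simp
    then have "vanishes_from d a i ?y"
      using f i diag by (auto simp: vanishes_from_def End_closed a_v)
    then have "vanishes_from d a 0 (krylov V f (\<lambda>j. t (i - 1 - j)) ?y i)"
      using krylov_kill[OF y _ i, of i] by simp
    then have "krylov V f (\<lambda>j. t (i - 1 - j)) ?y i = \<zero>\<^bsub>V\<^esub>"
      using vanishes_from_0 f y by simp
    then have "f (w i) \<oplus>\<^bsub>V\<^esub> (- t i) \<odot>\<^bsub>V\<^esub> w i = \<zero>\<^bsub>V\<^esub>"
      using f i by (simp add: krylov_shift w_def)
    then have "a (f (w i) \<oplus>\<^bsub>V\<^esub> (- t i) \<odot>\<^bsub>V\<^esub> w i) k = 0" if "k \<le> d" for k using that by simp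
    then show ?thesis using w_in[OF i] f by (intro a_eqI) (auto simp: End_closed)
  qed
  have lead_w: "a (w i) i \<noteq> 0" if i: "i \<le> d" for i
  proof -
    have "t i \<noteq> t (i - 1 - j)" if "j < i" for j
    proof -
      have "i - 1 - j \<noteq> i" "i - 1 - j \<le> d" using that i by auto
      then show ?thesis using inj i by (auto simp: inj_on_def)
    qed
    then show ?thesis using krylov_lead[OF i] by (simp add: w_def)
  qed
  have tri_w: "vanishes_from d a (Suc i) (w i)" if "i \<le> d" for i
    using krylov_lead[OF that] by (simp add: w_def)
  obtain b where b: "frame V d w b" "same_flag V d a b"
    using triangular_frame[OF w_in tri_w lead_w] by blast
  then show ?thesis using frame.eigenframe_of_eigenvectors[OF b(1) f eig inj] by blast
qed

end

section \<open>TH systems in coordinates\<close>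

text \<open>The two raising conditions gather all four conditions on the products \<open>E i A* E j\<close> and
  \<open>E* i A E* j\<close>, each of which concerns a single matrix entry.\<close>
locale th_frame = A: eigenframe V d v a A E \<theta> + B: eigenframe V d e b As Es \<theta>s
  for V :: "('k::field, 'v) module" and d v a A E \<theta> e b As Es \<theta>s +
  assumes As_raises: "raises V d a As" and A_raises: "raises V d b A"

lemma TH_systems_iff:
  "\<Phi> \<in> TH_systems d \<longleftrightarrow> (\<exists>v a \<theta> e b \<theta>s.
     th_frame (sp \<Phi>) d v a (opA \<Phi>) (idE \<Phi>) \<theta> e b (opAs \<Phi>) (idEs \<Phi>) \<theta>s)"
  (is "_ \<longleftrightarrow> ?R")
proof
  let ?V = "sp \<Phi>"
  assume T: "\<Phi> \<in> TH_systems d"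
  then have dim: "has_dim ?V (d + 1)" and mf: "mult_free ?V (opA \<Phi>)" "mult_free ?V (opAs \<Phi>)"
    and ord: "idem_ordering d ?V (opA \<Phi>) (idE \<Phi>)" "idem_ordering d ?V (opAs \<Phi>) (idEs \<Phi>)"
    by (simp_all add: TH_systems_def Let_def)
  obtain v a \<theta> where "eigenframe ?V d v a (opA \<Phi>) (idE \<Phi>) \<theta>"
    using eigenframe_exists[OF dim mf(1) ord(1)] by blast
  then interpret A: eigenframe ?V d v a "opA \<Phi>" "idE \<Phi>" \<theta> .
  obtain e b \<theta>s where "eigenframe ?V d e b (opAs \<Phi>) (idEs \<Phi>) \<theta>s"
    using eigenframe_exists[OF dim mf(2) ord(2)] by blast
  then interpret B: eigenframe ?V d e b "opAs \<Phi>" "idEs \<Phi>" \<theta>s .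
  have "raises ?V d a (opAs \<Phi>)"
    unfolding A.raises_iff[OF B.A_in] using T
    by (simp add: TH_systems_def Let_def A.E_f_E_zero_iff)
  moreover have "raises ?V d b (opA \<Phi>)"
    unfolding B.raises_iff[OF A.A_in] using T
    by (simp add: TH_systems_def Let_def B.E_f_E_zero_iff)
  ultimately have "th_frame ?V d v a (opA \<Phi>) (idE \<Phi>) \<theta> e b (opAs \<Phi>) (idEs \<Phi>) \<theta>s"
    by unfold_locales
  then show ?R by blast
next
  let ?V = "sp \<Phi>"
  assume ?R
  then obtain v a \<theta> e b \<theta>s where
    "th_frame ?V d v a (opA \<Phi>) (idE \<Phi>) \<theta> e b (opAs \<Phi>) (idEs \<Phi>) \<theta>s" by blast
  then interpret th_frame ?V d v a "opA \<Phi>" "idE \<Phi>" \<theta> e b "opAs \<Phi>" "idEs \<Phi>" \<theta>s .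
  have "has_dim ?V (d + 1)" by (rule A.has_dim_frame)
  then show "\<Phi> \<in> TH_systems d"
    using As_raises A_raises
    unfolding TH_systems_def Let_def A.raises_iff[OF B.A_in] B.raises_iff[OF A.A_in]
    by (simp add: A.mult_free A.idem_ordering B.mult_free B.idem_ordering
        A.E_f_E_zero_iff B.E_f_E_zero_iff)
qed

section \<open>The split basis\<close>

text \<open>The bidiagonal form of a TH system. The two flag conditions tie the basis \<open>u\<close> to the
  eigenbases: the spans of \<open>u 0, \<dots>, u i\<close> and \<open>e 0, \<dots>, e i\<close> agree, and so do the spans of
  \<open>u i, \<dots>, u d\<close> and \<open>v 0, \<dots>, v (d - i)\<close>. The actions of \<open>A\<close> and \<open>As\<close> are stated on the
  coordinates of an arbitrary vector, which is the form in which they are compared, rescaled and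
  composed.\<close>
locale split_frame = th_frame V d v a A E \<theta> e b As Es \<theta>s + U: frame V d u p
  for V :: "('k::field, 'v) module" and d v a A E \<theta> e b As Es \<theta>s u p +
  fixes \<phi> :: "nat \<Rightarrow> 'k"
  assumes flag_b: "same_flag V d b p"
    and flag_a: "same_flag V d a (\<lambda>x k. p x (d - k))"
    and p_A: "x \<in> carrier V \<Longrightarrow> k \<le> d \<Longrightarrow>
      p (A x) k = \<theta> (d - k) * p x k + (if k = 0 then 0 else p x (k - 1))"
    and p_As: "x \<in> carrier V \<Longrightarrow> k \<le> d \<Longrightarrow>
      p (As x) k = \<theta>s k * p x k + (if k < d then \<phi> (Suc k) * p x (Suc k) else 0)"
    and \<phi>_nonzero: "i \<in> {1..d} \<Longrightarrow> \<phi> i \<noteq> 0"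

context th_frame begin

text \<open>Each application of \<open>A\<close> raises the flag of the \<open>e i\<close> by exactly one step, whatever the
  shifts are.\<close>
lemma krylov_flag:
  "n \<le> d \<Longrightarrow> vanishes_from d b (Suc n) (krylov V A t (e 0) n) \<and> b (krylov V A t (e 0) n) n \<noteq> 0"
proof (induction n)
  case 0
  then show ?case using B.vanishes_from_v[of 0 1] by (simp add: B.a_v)
next
  case (Suc n)
  let ?y = "krylov V A t (e 0) n"
  have y: "?y \<in> carrier V" by simp
  have IH: "vanishes_from d b (Suc n) ?y" "b ?y n \<noteq> 0" using Suc by auto
  then have "vanishes_from d b (Suc (Suc n)) (A ?y)" "b (A ?y) (Suc n) \<noteq> 0"
    using A_raises Suc.prems y unfolding raises_def by (blast, simp)
  then show ?case using IH Suc.prems y by (auto simp: vanishes_from_def)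
qed

lemma a_krylov:
  "k \<le> d \<Longrightarrow> a (krylov V A t (e 0) n) k = (\<Prod>j<n. \<theta> k - t j) * a (e 0) k"
  by (induction n) (auto simp: algebra_simps)

text \<open>The vector \<open>e 0\<close> is cyclic for \<open>A\<close>. If its \<open>k\<close>-th eigencoordinate vanished, the product of
  the \<open>d\<close> factors \<open>A - \<theta> j\<close> with \<open>j \<noteq> k\<close> would annihilate it, while the product of \<open>d\<close>
  shifted copies of \<open>A\<close> takes \<open>e 0\<close> to a vector with non-zero coordinate at \<open>e d\<close>.\<close>
lemma e0_cyclic:
  assumes k: "k \<le> d"
  shows "a (e 0) k \<noteq> 0"
proof
  assume z: "a (e 0) k = 0"
  define t where "t j = \<theta> (if j < k then j else Suc j)" for j
  let ?y = "krylov V A t (e 0) d"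
  have "?y = \<zero>\<^bsub>V\<^esub>"
  proof (rule A.a_eqI)
    fix l assume l: "l \<le> d"
    have "(\<Prod>j<d. \<theta> l - t j) * a (e 0) l = 0"
    proof (cases "l = k")
      case False
      define j where "j = (if l < k then l else l - 1)"
      have "j < d" "t j = \<theta> l" using False l k by (auto simp: j_def t_def)
      then have "(\<Prod>j<d. \<theta> l - t j) = 0" by (intro prod_zero bexI[of _ j]) auto
      then show ?thesis by simp
    qed (simp add: z)
    then show "a ?y l = a \<zero>\<^bsub>V\<^esub> l" using l by (simp add: a_krylov)
  qed auto
  then show False using krylov_flag[of d t] by simp
qed

text \<open>The basis is \<open>u i = (A - \<theta> (d - i + 1)) \<dots> (A - \<theta> d) (e 0)\<close>. It follows the flag of the
  \<open>e i\<close> since \<open>A\<close> raises that flag. The factors in the product kill the eigencoordinates above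
  \<open>d - i\<close>, and cyclicity of \<open>e 0\<close> keeps the one at \<open>d - i\<close>, so the reversed basis follows the flag
  of the \<open>v i\<close>. The vector \<open>(As - \<theta>s i) (u i)\<close> is then confined by the first flag to
  \<open>u 0, \<dots>, u (i - 1)\<close> and by the second to \<open>u (i - 1), \<dots>, u d\<close>, hence is a multiple of
  \<open>u (i - 1)\<close>.\<close>
lemma split_frame_exists:
  "\<exists>u p \<phi>. split_frame V d v a A E \<theta> e b As Es \<theta>s u p \<phi>"
proof -
  define u where "u = krylov V A (\<lambda>j. \<theta> (d - j)) (e 0)"
  have u_in [simp]: "u i \<in> carrier V" for i by (simp add: u_def)
  have A_u: "A (u i) = \<theta> (d - i) \<odot>\<^bsub>V\<^esub> u i \<oplus>\<^bsub>V\<^esub> u (Suc i)" for i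
    by (rule A.a_eqI) (simp_all add: u_def)
  obtain p where pf: "frame V d u p" and flag_b: "same_flag V d b p"
    using B.triangular_frame[of u] krylov_flag unfolding u_def by auto
  interpret U: frame V d u p by fact
  have a_u: "a (u i) k = (\<Prod>j<i. \<theta> k - \<theta> (d - j)) * a (e 0) k" if "k \<le> d" for i k
    using that by (simp add: u_def a_krylov)
  have a_u0: "a (u i) k = 0" if "k \<le> d" "d - i < k" for i k
  proof -
    have "d - k < i" "d - (d - k) = k" using that by auto
    then have "(\<Prod>j<i. \<theta> k - \<theta> (d - j)) = 0" by (intro prod_zero bexI[of _ "d - k"]) auto
    then show ?thesis using that by (simp add: a_u)
  qed
  \<comment> \<open>All \<open>d + 1\<close> eigenvalues occur among the factors, so the recursion stops at \<open>d\<close>.\<close>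
  have "u (Suc d) = \<zero>\<^bsub>V\<^esub>"
  proof (rule A.a_eqI)
    fix k assume "k \<le> d"
    then have "(\<Prod>j<Suc d. \<theta> k - \<theta> (d - j)) = 0"
      by (intro prod_zero bexI[of _ "d - k"]) auto
    then show "a (u (Suc d)) k = a \<zero>\<^bsub>V\<^esub> k" using \<open>k \<le> d\<close> by (simp add: a_u)
  qed auto
  then have p_u: "p (u (Suc i)) k = (if k = Suc i then 1 else 0)" if "i \<le> d" "k \<le> d" for i k
    using that by (cases "i = d") (auto simp: U.a_v)
  have rev: "frame V d (\<lambda>i. u (d - i)) (\<lambda>x k. p x (d - k))"
    by (rule U.reindex) (rule bij_betwI[where g = "\<lambda>i. d - i"]; auto)
  have flag_a: "same_flag V d a (\<lambda>x k. p x (d - k))"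
  proof (rule A.triangular_same_flag[OF rev])
    fix i assume i: "i \<le> d"
    show "vanishes_from d a (Suc i) (u (d - i))" using i by (auto simp: vanishes_from_def a_u0)
    have "\<theta> i \<noteq> \<theta> (d - j)" if "j < d - i" for j
      using inj_onD[OF A.\<theta>_inj, of i "d - j"] i that by auto
    then show "a (u (d - i)) i \<noteq> 0" using i by (simp add: a_u e0_cyclic)
  qed
  have p_A: "p (A x) k = \<theta> (d - k) * p x k + (if k = 0 then 0 else p x (k - 1))"
    if x: "x \<in> carrier V" "k \<le> d" for x k
  proof -
    have "p (A x) k = (\<Sum>j\<in>{0..d}. p x j * p (A (u j)) k)"
      by (rule U.expand_End[OF pf A.A_in x])
    also have "\<dots> = (\<Sum>j\<in>{0..d}. (if j = k then \<theta> (d - k) * p x k else 0)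
        + (if Suc j = k then p x (k - 1) else 0))"
      using x by (intro sum.cong) (auto simp: A_u p_u U.a_v)
    also have "\<dots> = \<theta> (d - k) * p x k + (if k = 0 then 0 else p x (k - 1))"
      using x by (cases k) (auto simp: sum.distrib)
    finally show ?thesis .
  qed
  define \<phi> where "\<phi> i = p (As (u i)) (i - 1)" for i
  have p_As_u: "p (As (u i)) k = (if k = i then \<theta>s i else if Suc k = i then \<phi> i else 0)"
    if i: "i \<le> d" and k: "k \<le> d" for i k
  proof -
    let ?y = "As (u i) \<oplus>\<^bsub>V\<^esub> (- \<theta>s i) \<odot>\<^bsub>V\<^esub> u i"
    have u_flag: "vanishes_from d b (Suc i) (u i)" "vanishes_from d a (Suc (d - i)) (u i)"
      using i krylov_flag[OF i] a_u0 by (auto simp: u_def vanishes_from_def)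
    have "vanishes_from d b i ?y"
      using u_flag(1) i by (simp add: vanishes_from_Suc) (auto simp: vanishes_from_def)
    then have "vanishes_from d p i ?y" using same_flagD[OF flag_b, of ?y i] by simp
    then have above: "p ?y k = 0" if "i \<le> k" using that k by (simp add: vanishes_from_def)
    have "vanishes_from d a (Suc (Suc (d - i))) (As (u i))"
      using As_raises u_flag(2) by (simp add: raises_def)
    then have "vanishes_from d a (Suc (Suc (d - i))) ?y"
      using u_flag(2) by (auto simp: vanishes_from_def)
    then have "vanishes_from d (\<lambda>x k. p x (d - k)) (Suc (Suc (d - i))) ?y"
      using same_flagD[OF flag_a, of ?y] by simp
    then have "p ?y (d - (d - k)) = 0" if "Suc k < i"
      using that k i by (intro vanishes_fromD[of d "\<lambda>x k. p x (d - k)"]) auto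
    then have below: "p ?y k = 0" if "Suc k < i" using that k by simp
    have py: "p ?y k = p (As (u i)) k - \<theta>s i * (if k = i then 1 else 0)"
      using i k by (simp add: U.a_v)
    consider "i \<le> k" | "Suc k < i" | "Suc k = i" by linarith
    then show ?thesis
    proof cases
      case 1
      then show ?thesis using above py by auto
    next
      case 2
      then show ?thesis using below py by auto
    next
      case 3
      then show ?thesis by (auto simp: \<phi>_def)
    qed
  qed
  have p_As: "p (As x) k = \<theta>s k * p x k + (if k < d then \<phi> (Suc k) * p x (Suc k) else 0)"
    if x: "x \<in> carrier V" "k \<le> d" for x k
  proof -
    have "p (As x) k = (\<Sum>j\<in>{0..d}. p x j * p (As (u j)) k)"
      by (rule U.expand_End[OF pf B.A_in x])
    also have "\<dots> = (\<Sum>j\<in>{0..d}. (if j = k then \<theta>s k * p x k else 0)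
        + (if j = Suc k then \<phi> (Suc k) * p x (Suc k) else 0))"
      using x by (intro sum.cong) (auto simp: p_As_u)
    also have "\<dots> = \<theta>s k * p x k + (if k < d then \<phi> (Suc k) * p x (Suc k) else 0)"
      using x by (auto simp: sum.distrib)
    finally show ?thesis .
  qed
  have nonzero: "\<phi> i \<noteq> 0" if i: "i \<in> {1..d}" for i
  proof
    \<comment> \<open>The span of \<open>u i, \<dots>, u d\<close>, which contains \<open>v (d - i)\<close>, would be invariant under \<open>As\<close>. But
      \<open>As\<close> takes \<open>v (d - i)\<close> out of the span of \<open>v 0, \<dots>, v (d - i)\<close>.\<close>
    assume z: "\<phi> i = 0"
    let ?m = "d - i"
    have m: "?m < d" using i by auto
    have "vanishes_from d a (Suc ?m) (v ?m)" by (rule A.vanishes_from_v) auto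
    then have "vanishes_from d (\<lambda>x k. p x (d - k)) (Suc ?m) (v ?m)"
      using same_flagD[OF flag_a, of "v ?m"] by simp
    then have v0: "p (v ?m) k = 0" if "k < i" for k
      using vanishes_fromD[of d "\<lambda>x k. p x (d - k)" "Suc ?m" "v ?m" "d - k"] that i by auto
    have "p (As (v ?m)) k = 0" if "k < i" for k
      using that i z by (cases "Suc k = i") (auto simp: p_As v0)
    then have "vanishes_from d (\<lambda>x k. p x (d - k)) (Suc ?m) (As (v ?m))"
      using i by (auto simp: vanishes_from_def)
    then have "vanishes_from d a (Suc ?m) (As (v ?m))"
      using same_flagD[OF flag_a, of "As (v ?m)"] by simp
    then have "a (As (v ?m)) (Suc ?m) = 0" using m by (simp add: vanishes_from_def)
    then show False using As_raises[unfolded A.raises_iff[OF B.A_in]] m by simp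
  qed
  have "split_frame V d v a A E \<theta> e b As Es \<theta>s u p \<phi>"
    by (intro split_frame.intro split_frame_axioms.intro th_frame_axioms pf flag_b flag_a p_A p_As nonzero)
  then show ?thesis by blast
qed

end

context split_frame begin

text \<open>The sum of the \<open>E* j V\<close> bounds the coordinates with respect to \<open>u\<close> from above and the sum of
  the \<open>E j V\<close> bounds them from below; only the line through \<open>u i\<close> remains.\<close>
lemma split_space_eq:
  assumes "sp \<Phi> = V" "idE \<Phi> = E" "idEs \<Phi> = Es" "i \<le> d"
  shows "split_space d \<Phi> i = {x \<in> carrier V. \<forall>k\<le>d. k \<noteq> i \<longrightarrow> p x k = 0}"
proof -
  have "(\<forall>k\<le>d. i < k \<longrightarrow> b x k = 0) \<and> (\<forall>k\<le>d. d - i < k \<longrightarrow> a x k = 0)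
      \<longleftrightarrow> (\<forall>k\<le>d. k \<noteq> i \<longrightarrow> p x k = 0)" if x: "x \<in> carrier V" for x
  proof -
    have "(\<forall>k\<le>d. i < k \<longrightarrow> b x k = 0) \<longleftrightarrow> vanishes_from d p (Suc i) x"
      unfolding same_flagD[OF flag_b x, symmetric] by (auto simp: vanishes_from_def)
    moreover have "(\<forall>k\<le>d. d - i < k \<longrightarrow> a x k = 0) \<longleftrightarrow> (\<forall>k<i. p x k = 0)"
    proof -
      have "(\<forall>k\<le>d. d - i < k \<longrightarrow> a x k = 0) \<longleftrightarrow> vanishes_from d (\<lambda>x k. p x (d - k)) (Suc (d - i)) x"
        unfolding same_flagD[OF flag_a x, symmetric] by (auto simp: vanishes_from_def)
      also have "\<dots> \<longleftrightarrow> (\<forall>k<i. p x k = 0)"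
      proof
        assume *: "vanishes_from d (\<lambda>x k. p x (d - k)) (Suc (d - i)) x"
        show "\<forall>k<i. p x k = 0"
        proof (intro allI impI)
          fix k assume "k < i"
          then show "p x k = 0"
            using vanishes_fromD[OF *, of "d - k"] \<open>i \<le> d\<close> by auto
        qed
      qed (use \<open>i \<le> d\<close> in \<open>auto simp: vanishes_from_def\<close>)
      finally show ?thesis .
    qed
    ultimately show ?thesis
      using \<open>i \<le> d\<close> by (auto simp: vanishes_from_def Suc_le_eq nat_neq_iff)
  qed
  then show ?thesis
    using assms by (auto simp: split_space_def A.sum_spaces_E B.sum_spaces_E)
qed

lemma parr_of_eq:
  assumes \<Phi>: "sp \<Phi> = V" "opA \<Phi> = A" "idE \<Phi> = E" "opAs \<Phi> = As" "idEs \<Phi> = Es"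
  shows "parr_of d \<Phi> = (restrict \<theta> {0..d}, restrict \<theta>s {0..d}, restrict \<phi> {1..d})"
proof -
  have eig: "eig_seq d \<Phi> = restrict \<theta> {0..d}" and dual: "dual_eig_seq d \<Phi> = restrict \<theta>s {0..d}"
    unfolding eig_seq_def dual_eig_seq_def \<Phi>
    by (intro restrict_ext; simp add: A.the_eigenvalue B.the_eigenvalue)+
  have "split_seq d \<Phi> i = \<phi> i" if i: "i \<in> {1..d}" for i
  proof -
    let ?X = "End_alg V"
    let ?f = "(A \<ominus>\<^bsub>?X\<^esub> \<theta> (d - i + 1) \<odot>\<^bsub>?X\<^esub> \<one>\<^bsub>?X\<^esub>) \<otimes>\<^bsub>?X\<^esub> (As \<ominus>\<^bsub>?X\<^esub> \<theta>s i \<odot>\<^bsub>?X\<^esub> \<one>\<^bsub>?X\<^esub>)"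
    have sp: "split_space d \<Phi> i = {x \<in> carrier V. \<forall>k\<le>d. k \<noteq> i \<longrightarrow> p x k = 0}"
      using split_space_eq \<Phi> i by simp
    have f: "?f x = \<phi> i \<odot>\<^bsub>V\<^esub> x" if "x \<in> split_space d \<Phi> i" for x
    proof -
      have x: "x \<in> carrier V" "\<And>k. k \<le> d \<Longrightarrow> k \<noteq> i \<Longrightarrow> p x k = 0" using that by (auto simp: sp)
      let ?y = "As x \<oplus>\<^bsub>V\<^esub> (- 1) \<odot>\<^bsub>V\<^esub> (\<theta>s i \<odot>\<^bsub>V\<^esub> x)"
      have y: "?y \<in> carrier V" using x by simp
      have fx: "?f x = A ?y \<oplus>\<^bsub>V\<^esub> (- 1) \<odot>\<^bsub>V\<^esub> (\<theta> (d - i + 1) \<odot>\<^bsub>V\<^esub> ?y)"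
        using x y by (simp add: End_mult_apply A.End_minus_apply A.End_alg_closed End_smult_apply End_one_apply)
      have py: "p ?y k = (if Suc k = i then \<phi> i * p x i else 0)" if "k \<le> d" for k
        using that x i by (cases "k = i"; cases "Suc k = i") (auto simp: p_As)
      show ?thesis unfolding fx
      proof (rule U.a_eqI)
        fix k assume k: "k \<le> d"
        have "p (A ?y \<oplus>\<^bsub>V\<^esub> (- 1) \<odot>\<^bsub>V\<^esub> (\<theta> (d - i + 1) \<odot>\<^bsub>V\<^esub> ?y)) k =
            \<theta> (d - k) * p ?y k + (if k = 0 then 0 else p ?y (k - 1)) - \<theta> (d - i + 1) * p ?y k"
          using k y p_A[OF y k] by (simp del: U.a_add add: U.a_add[OF A.A_closed])
        also have "\<dots> = \<phi> i * p x k"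
        proof -
          consider "Suc k = i" | "k = i" | "Suc k \<noteq> i" "k \<noteq> i" by blast
          then show ?thesis
          proof cases
            case 1
            then have "d - k = d - i + 1" "k \<noteq> i" using i by auto
            then show ?thesis using k 1 x py[of k] py[of "k - 1"] by auto
          next
            case 2
            then show ?thesis using k i py[of k] py[of "k - 1"] by auto
          next
            case 3
            then show ?thesis using k x(2)[of k] py[of k] py[of "k - 1"] by auto
          qed
        qed
        finally show "p (A ?y \<oplus>\<^bsub>V\<^esub> (- 1) \<odot>\<^bsub>V\<^esub> (\<theta> (d - i + 1) \<odot>\<^bsub>V\<^esub> ?y)) k = p (\<phi> i \<odot>\<^bsub>V\<^esub> x) k"
          using k x by simp
      qed (use x y in auto)
    qed
    have u: "u i \<in> split_space d \<Phi> i" using i by (auto simp: sp U.a_v)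
    have "(THE c. \<forall>x\<in>split_space d \<Phi> i. ?f x = c \<odot>\<^bsub>V\<^esub> x) = \<phi> i"
    proof (rule the_equality)
      fix c assume "\<forall>x\<in>split_space d \<Phi> i. ?f x = c \<odot>\<^bsub>V\<^esub> x"
      then have "c \<odot>\<^bsub>V\<^esub> u i = \<phi> i \<odot>\<^bsub>V\<^esub> u i" using f[OF u] u by simp
      then have "p (c \<odot>\<^bsub>V\<^esub> u i) i = p (\<phi> i \<odot>\<^bsub>V\<^esub> u i) i" by simp
      then show "c = \<phi> i" using i by (simp add: U.a_v)
    qed (use f in blast)
    moreover have "d - i + 1 \<in> {0..d}" "i \<in> {0..d}" using i by auto
    ultimately show ?thesis
      unfolding split_seq_def eig dual \<Phi> Let_def by (simp only: i restrict_apply' if_True)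
  qed
  then have "split_seq d \<Phi> = restrict \<phi> {1..d}"
    by (intro extensionalityI[of _ "{1..d}"]) (auto simp: split_seq_def)
  then show ?thesis by (simp add: parr_of_def eig dual)
qed

lemma in_param_arrays: "(restrict \<theta> {0..d}, restrict \<theta>s {0..d}, restrict \<phi> {1..d}) \<in> param_arrays d"
  using A.\<theta>_inj B.\<theta>_inj \<phi>_nonzero by (auto simp: param_arrays_def inj_on_def)

end

section \<open>Isomorphic TH systems have the same parameter array\<close>
lemma (in eigenframe) eigenvalue_iff:
  assumes "i \<le> d"
  shows "A \<otimes>\<^bsub>End_alg V\<^esub> E i = c \<odot>\<^bsub>End_alg V\<^esub> E i \<longleftrightarrow> c = \<theta> i"
proof
  assume "A \<otimes>\<^bsub>End_alg V\<^esub> E i = c \<odot>\<^bsub>End_alg V\<^esub> E i"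
  then have "(A \<otimes>\<^bsub>End_alg V\<^esub> E i) (v i) = (c \<odot>\<^bsub>End_alg V\<^esub> E i) (v i)" by simp
  then have "A (v i) = c \<odot>\<^bsub>V\<^esub> v i" using assms by (simp add: End_apply E_v)
  then have "a (A (v i)) i = a (c \<odot>\<^bsub>V\<^esub> v i) i" by simp
  then show "c = \<theta> i" using assms by (simp add: a_v)
next
  assume "c = \<theta> i"
  then show "A \<otimes>\<^bsub>End_alg V\<^esub> E i = c \<odot>\<^bsub>End_alg V\<^esub> E i"
    using assms by (intro End_eq_on_frame) (auto simp: End_alg_closed End_apply intro!: a_eqI)
qed

text \<open>The \<open>n\<close>-th value at \<open>E* 0\<close> is the element \<open>(A - \<theta> (d - n + 1)) \<dots> (A - \<theta> d) E* 0\<close> of the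
  endomorphism algebra, whose image is the \<open>n\<close>-th split space. It lets split vectors be handled by an
  algebra isomorphism, which does not act on vectors.\<close>
definition split_op :: "nat \<Rightarrow> ('k::field, 'v) module \<Rightarrow> ('v \<Rightarrow> 'v) \<Rightarrow> (nat \<Rightarrow> 'k) \<Rightarrow> ('v \<Rightarrow> 'v) \<Rightarrow> nat \<Rightarrow> 'v \<Rightarrow> 'v" where
  "split_op d V A \<theta> = krylov (End_alg V) (\<lambda>g. A \<otimes>\<^bsub>End_alg V\<^esub> g) (\<lambda>j. \<theta> (d - j))"

lemma (in split_frame) split_op_apply:
  "split_op d V A \<theta> (Es 0) n \<in> carrier (End_alg V)" (is ?P)
  "x \<in> carrier V \<Longrightarrow> n \<le> d \<Longrightarrow> k \<le> d \<Longrightarrow>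
    p (split_op d V A \<theta> (Es 0) n x) k = (if k = n then p (Es 0 x) 0 else 0)" (is "_ \<Longrightarrow> _ \<Longrightarrow> _ \<Longrightarrow> ?Q n k")
proof -
  show in_End: "split_op d V A \<theta> (Es 0) n \<in> carrier (End_alg V)" for n
    unfolding split_op_def by (induction n) (auto simp: A.End_alg_closed)
  assume x: "x \<in> carrier V"
  show "n \<le> d \<Longrightarrow> k \<le> d \<Longrightarrow> ?Q n k"
  proof (induction n arbitrary: k)
    case 0
    have "vanishes_from d b 1 (Es 0 x)" using x by (auto simp: vanishes_from_def)
    then have "vanishes_from d p 1 (Es 0 x)" using same_flagD[OF flag_b, of "Es 0 x"] x by simp
    then show ?case using 0 by (auto simp: split_op_def vanishes_from_def)
  next
    case (Suc n)
    let ?y = "split_op d V A \<theta> (Es 0) n x"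
    have y: "?y \<in> carrier V" using in_End x by (rule End_closed)
    have "split_op d V A \<theta> (Es 0) (Suc n) x = A ?y \<oplus>\<^bsub>V\<^esub> (- \<theta> (d - n)) \<odot>\<^bsub>V\<^esub> ?y"
      using x by (simp add: split_op_def End_apply)
    then show ?case using Suc y by (auto simp: p_A)
  qed
qed

text \<open>The image of \<open>X\<close> is the \<open>i\<close>-th split space, on which \<open>(A - \<theta> (d - i + 1)) (As - \<theta>s i)\<close> acts
  as \<open>\<phi> i\<close>. So \<open>\<phi> i\<close> is characterized inside the algebra.\<close>
lemma (in split_frame) split_eigenvalue_iff:
  fixes c
  assumes i: "i \<in> {1..d}"
  defines "X \<equiv> split_op d V A \<theta> (Es 0) i"
  defines "Y \<equiv> As \<otimes>\<^bsub>End_alg V\<^esub> X \<oplus>\<^bsub>End_alg V\<^esub> (- \<theta>s i) \<odot>\<^bsub>End_alg V\<^esub> X"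
  shows "A \<otimes>\<^bsub>End_alg V\<^esub> Y \<oplus>\<^bsub>End_alg V\<^esub> (- \<theta> (d - i + 1)) \<odot>\<^bsub>End_alg V\<^esub> Y = c \<odot>\<^bsub>End_alg V\<^esub> X \<longleftrightarrow> c = \<phi> i"
    (is "?L = _ \<longleftrightarrow> _")
proof -
  have X: "X \<in> carrier (End_alg V)" unfolding X_def by (rule split_op_apply)
  then have Y: "Y \<in> carrier (End_alg V)" unfolding Y_def by (simp add: A.End_alg_closed)
  have pX: "p (X x) k = (if k = i then p (Es 0 x) 0 else 0)" if "x \<in> carrier V" "k \<le> d" for x k
    using split_op_apply(2) that i by (simp add: X_def)
  have pY: "p (Y x) k = (if Suc k = i then \<phi> i * p (Es 0 x) 0 else 0)" if x: "x \<in> carrier V" "k \<le> d" for x k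
    using that i End_closed[OF X x(1)] by (auto simp: Y_def End_apply p_As pX)
  have pL: "p (?L x) k = \<phi> i * p (X x) k" if x: "x \<in> carrier V" "k \<le> d" for x k
  proof -
    have "p (?L x) k = \<theta> (d - k) * p (Y x) k + (if k = 0 then 0 else p (Y x) (k - 1)) - \<theta> (d - i + 1) * p (Y x) k"
      using x End_closed[OF Y x(1)] by (simp add: End_apply p_A)
    moreover have "d - k = d - i + 1" if "Suc k = i" using that i by auto
    ultimately show ?thesis using x i by (auto simp: pX pY)
  qed
  show ?thesis
  proof
    assume "?L = c \<odot>\<^bsub>End_alg V\<^esub> X"
    then have "p (?L (e 0)) i = p (c \<odot>\<^bsub>V\<^esub> X (e 0)) i" by (simp add: End_smult_apply)
    moreover have "p (?L (e 0)) i = \<phi> i * p (X (e 0)) i" using i by (intro pL) auto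
    ultimately have "(\<phi> i - c) * p (e 0) 0 = 0"
      using i End_closed[OF X, of "e 0"] by (auto simp: pX B.E_v)
    moreover have "p (e 0) 0 \<noteq> 0"
      using same_flag_lead[OF flag_b, of "e 0" 0] B.vanishes_from_v[of 0 1] by (simp add: B.a_v)
    ultimately show "c = \<phi> i" by simp
  next
    assume "c = \<phi> i"
    then show "?L = c \<odot>\<^bsub>End_alg V\<^esub> X"
      using X Y by (intro End_eqI[of _ V] U.a_eqI)
        (auto simp: A.End_alg_closed pL[simplified] End_smult_apply End_closed)
  qed
qed

lemma isomorphic_imp_parr_eq:
  assumes S: "split_frame (sp \<Phi>) d v a (opA \<Phi>) (idE \<Phi>) \<theta> e b (opAs \<Phi>) (idEs \<Phi>) \<theta>s u p \<phi>"
    and S': "split_frame (sp \<Psi>) d v' a' (opA \<Psi>) (idE \<Psi>) \<theta>' e' b' (opAs \<Psi>) (idEs \<Psi>) \<theta>s' u' p' \<phi>'"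
    and iso: "th_isomorphic d \<Phi> \<Psi>"
  shows "parr_of d \<Phi> = parr_of d \<Psi>"
proof -
  interpret S: split_frame "sp \<Phi>" d v a "opA \<Phi>" "idE \<Phi>" \<theta> e b "opAs \<Phi>" "idEs \<Phi>" \<theta>s u p \<phi> by (rule S)
  interpret S': split_frame "sp \<Psi>" d v' a' "opA \<Psi>" "idE \<Psi>" \<theta>' e' b' "opAs \<Psi>" "idEs \<Psi>" \<theta>s' u' p' \<phi>' by (rule S')
  let ?X = "End_alg (sp \<Phi>)" and ?Y = "End_alg (sp \<Psi>)"
  obtain \<gamma> where \<gamma>: "\<gamma> \<in> alg_iso ?X ?Y"
    and im: "opA \<Psi> = \<gamma> (opA \<Phi>)" "opAs \<Psi> = \<gamma> (opAs \<Phi>)"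
      "\<And>i. i \<le> d \<Longrightarrow> idE \<Psi> i = \<gamma> (idE \<Phi> i)" "\<And>i. i \<le> d \<Longrightarrow> idEs \<Psi> i = \<gamma> (idEs \<Phi> i)"
    using iso by (auto simp: th_isomorphic_def)
  have mult: "\<gamma> (f \<otimes>\<^bsub>?X\<^esub> g) = \<gamma> f \<otimes>\<^bsub>?Y\<^esub> \<gamma> g" and add: "\<gamma> (f \<oplus>\<^bsub>?X\<^esub> g) = \<gamma> f \<oplus>\<^bsub>?Y\<^esub> \<gamma> g"
    and smult: "\<gamma> (c \<odot>\<^bsub>?X\<^esub> f) = c \<odot>\<^bsub>?Y\<^esub> \<gamma> f"
    if "f \<in> carrier ?X" "g \<in> carrier ?X" for f g c
    using \<gamma> that by (auto simp: alg_iso_def ring_iso_def ring_hom_mult ring_hom_add)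
  note cl = S.A.End_alg_closed S.A.A_in S.B.A_in
  have \<theta>: "\<theta> i = \<theta>' i" if i: "i \<le> d" for i
  proof -
    have "\<gamma> (opA \<Phi> \<otimes>\<^bsub>?X\<^esub> idE \<Phi> i) = \<gamma> (\<theta> i \<odot>\<^bsub>?X\<^esub> idE \<Phi> i)"
      using S.A.eigenvalue_iff[OF i, of "\<theta> i"] by simp
    then have "opA \<Psi> \<otimes>\<^bsub>?Y\<^esub> idE \<Psi> i = \<theta> i \<odot>\<^bsub>?Y\<^esub> idE \<Psi> i"
      using i S.A.E_in[OF i] by (simp add: mult smult im)
    then show ?thesis using S'.A.eigenvalue_iff[OF i, of "\<theta> i"] by simp
  qed
  have \<theta>s: "\<theta>s i = \<theta>s' i" if i: "i \<le> d" for i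
  proof -
    have "\<gamma> (opAs \<Phi> \<otimes>\<^bsub>?X\<^esub> idEs \<Phi> i) = \<gamma> (\<theta>s i \<odot>\<^bsub>?X\<^esub> idEs \<Phi> i)"
      using S.B.eigenvalue_iff[OF i, of "\<theta>s i"] by simp
    then have "opAs \<Psi> \<otimes>\<^bsub>?Y\<^esub> idEs \<Psi> i = \<theta>s i \<odot>\<^bsub>?Y\<^esub> idEs \<Psi> i"
      using i S.B.E_in[OF i] by (simp add: mult smult im)
    then show ?thesis using S'.B.eigenvalue_iff[OF i, of "\<theta>s i"] by simp
  qed
  have op: "\<gamma> (split_op d (sp \<Phi>) (opA \<Phi>) \<theta> (idEs \<Phi> 0) n) = split_op d (sp \<Psi>) (opA \<Psi>) \<theta>' (idEs \<Psi> 0) n" for n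
  proof (induction n)
    case 0
    show ?case by (simp add: split_op_def im)
  next
    case (Suc n)
    let ?Z = "split_op d (sp \<Phi>) (opA \<Phi>) \<theta> (idEs \<Phi> 0) n"
    have Z: "?Z \<in> carrier ?X" by (rule S.split_op_apply)
    have "\<gamma> (opA \<Phi> \<otimes>\<^bsub>?X\<^esub> ?Z \<oplus>\<^bsub>?X\<^esub> (- \<theta> (d - n)) \<odot>\<^bsub>?X\<^esub> ?Z) =
      opA \<Psi> \<otimes>\<^bsub>?Y\<^esub> \<gamma> ?Z \<oplus>\<^bsub>?Y\<^esub> (- \<theta>' (d - n)) \<odot>\<^bsub>?Y\<^esub> \<gamma> ?Z"
      using Z by (simp add: mult add smult[OF _ Z] cl im \<theta>)
    then show ?case unfolding Suc by (simp add: split_op_def)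
  qed
  have \<phi>: "\<phi> i = \<phi>' i" if i: "i \<in> {1..d}" for i
  proof -
    let ?Z = "split_op d (sp \<Phi>) (opA \<Phi>) \<theta> (idEs \<Phi> 0) i"
    have Z: "?Z \<in> carrier ?X" by (rule S.split_op_apply)
    let ?W = "opAs \<Phi> \<otimes>\<^bsub>?X\<^esub> ?Z \<oplus>\<^bsub>?X\<^esub> (- \<theta>s i) \<odot>\<^bsub>?X\<^esub> ?Z"
    have W: "?W \<in> carrier ?X" using Z by (simp add: cl)
    have \<gamma>W: "\<gamma> ?W = opAs \<Psi> \<otimes>\<^bsub>?Y\<^esub> \<gamma> ?Z \<oplus>\<^bsub>?Y\<^esub> (- \<theta>s i) \<odot>\<^bsub>?Y\<^esub> \<gamma> ?Z"
      using Z by (simp add: mult add smult[OF _ Z] cl im)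
    have "\<gamma> (opA \<Phi> \<otimes>\<^bsub>?X\<^esub> ?W \<oplus>\<^bsub>?X\<^esub> (- \<theta> (d - i + 1)) \<odot>\<^bsub>?X\<^esub> ?W) = \<gamma> (\<phi> i \<odot>\<^bsub>?X\<^esub> ?Z)"
      using S.split_eigenvalue_iff[OF i, of "\<phi> i"] by simp
    then have "opA \<Psi> \<otimes>\<^bsub>?Y\<^esub> \<gamma> ?W \<oplus>\<^bsub>?Y\<^esub> (- \<theta> (d - i + 1)) \<odot>\<^bsub>?Y\<^esub> \<gamma> ?W = \<phi> i \<odot>\<^bsub>?Y\<^esub> \<gamma> ?Z"
      using add[of "opA \<Phi> \<otimes>\<^bsub>?X\<^esub> ?W" "(- \<theta> (d - i + 1)) \<odot>\<^bsub>?X\<^esub> ?W"] mult[of "opA \<Phi>" ?W] smult[OF W W] smult[OF Z Z] W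
      by (simp add: cl(1,3-) im(1))
    moreover have "\<theta> (d - i + 1) = \<theta>' (d - i + 1)" "\<theta>s i = \<theta>s' i" using i by (auto intro!: \<theta> \<theta>s)
    ultimately show ?thesis
      using S'.split_eigenvalue_iff[OF i, of "\<phi> i"] unfolding \<gamma>W op by simp
  qed
  show ?thesis
    using S.parr_of_eq[of \<Phi>] S'.parr_of_eq[of \<Psi>] \<theta> \<theta>s \<phi> by (auto intro!: restrict_ext)
qed

section \<open>TH systems with the same parameter array are isomorphic\<close>

text \<open>Two spaces with bases of the same length. The map \<open>transfer\<close> takes one basis to the other, and
  \<open>transport\<close> is conjugation by it.\<close>
locale two_frames = F: frame V d u p + G: frame W d u' p'
  for V :: "('k::field, 'v) module" and d u p and W :: "('k, 'w) module" and u' p'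
begin

definition transfer :: "'v \<Rightarrow> 'w" where "transfer x = G.vec_of (p x)"

definition transport :: "('v \<Rightarrow> 'v) \<Rightarrow> 'w \<Rightarrow> 'w" where
  "transport f = (\<lambda>y\<in>carrier W. transfer (f (F.vec_of (p' y))))"

lemma transfer_in [simp]: "transfer x \<in> carrier W"
  by (simp add: transfer_def)

lemma p_transfer [simp]: "k \<le> d \<Longrightarrow> p' (transfer x) k = p x k"
  by (simp add: transfer_def)

lemma transfer_back [simp]: "x \<in> carrier V \<Longrightarrow> F.vec_of (p' (transfer x)) = x"
  by (rule F.a_eqI) auto

lemma transfer_onto: "y \<in> carrier W \<Longrightarrow> transfer (F.vec_of (p' y)) = y"
  by (rule G.a_eqI) auto

lemma transfer_add: "x \<in> carrier V \<Longrightarrow> y \<in> carrier V \<Longrightarrow> transfer (x \<oplus>\<^bsub>V\<^esub> y) = transfer x \<oplus>\<^bsub>W\<^esub> transfer y"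
  by (rule G.a_eqI) auto

lemma transfer_smult: "x \<in> carrier V \<Longrightarrow> transfer (c \<odot>\<^bsub>V\<^esub> x) = c \<odot>\<^bsub>W\<^esub> transfer x"
  by (rule G.a_eqI) auto

lemma transfer_zero: "transfer \<zero>\<^bsub>V\<^esub> = \<zero>\<^bsub>W\<^esub>"
  by (rule G.a_eqI) auto

lemma transfer_inj: "x \<in> carrier V \<Longrightarrow> y \<in> carrier V \<Longrightarrow> transfer x = transfer y \<longleftrightarrow> x = y"
  using transfer_back by metis

lemma transport_transfer [simp]: "x \<in> carrier V \<Longrightarrow> transport f (transfer x) = transfer (f x)"
  by (simp add: transport_def)

lemma transfer_cases:
  assumes "y \<in> carrier W" obtains x where "x \<in> carrier V" "y = transfer x"
  using transfer_onto[OF assms] F.vec_of_in by metis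

lemma transport_in [simp]:
  assumes f: "f \<in> carrier (End_alg V)"
  shows "transport f \<in> carrier (End_alg W)"
proof -
  have "transport f (y \<oplus>\<^bsub>W\<^esub> z) = transport f y \<oplus>\<^bsub>W\<^esub> transport f z" if "y \<in> carrier W" "z \<in> carrier W" for y z
    using that f by (elim transfer_cases) (simp add: transfer_add[symmetric] End_add End_closed)
  moreover have "transport f (c \<odot>\<^bsub>W\<^esub> y) = c \<odot>\<^bsub>W\<^esub> transport f y" if "y \<in> carrier W" for y c
    using that f by (elim transfer_cases) (simp add: transfer_smult[symmetric] End_smult End_closed)
  ultimately show ?thesis by (auto simp: carrier_End transport_def)
qed

lemma transport_eqI:
  assumes "f \<in> carrier (End_alg V)" "g \<in> carrier (End_alg W)"
    and "\<And>x. x \<in> carrier V \<Longrightarrow> g (transfer x) = transfer (f x)"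
  shows "transport f = g"
  by (rule End_eqI[OF transport_in[OF assms(1)] assms(2)]) (use assms(3) in \<open>auto elim!: transfer_cases\<close>)

end

text \<open>Exchanging the two bases provides the inverse maps.\<close>
sublocale two_frames \<subseteq> sym: two_frames W d u' p' V u p ..

context two_frames begin

lemma transport_inverse:
  assumes "g \<in> carrier (End_alg W)"
  shows "transport (sym.transport g) = g"
proof (rule transport_eqI)
  fix x assume "x \<in> carrier V"
  then show "g (transfer x) = transfer (sym.transport g x)"
    using assms by (simp add: sym.transport_def sym.transfer_def transfer_def[symmetric] transfer_onto End_closed)
qed (use assms in auto)

end

lemma (in two_frames) transport_alg_iso: "transport \<in> alg_iso (End_alg V) (End_alg W)"
proof -
  note cl = F.End_alg_closed G.End_alg_closed
  have "transport \<in> Ring.ring_hom (End_alg V) (End_alg W)"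
  proof (rule ring_hom_memI)
    fix f g assume fg: "f \<in> carrier (End_alg V)" "g \<in> carrier (End_alg V)"
    show "transport (f \<otimes>\<^bsub>End_alg V\<^esub> g) = transport f \<otimes>\<^bsub>End_alg W\<^esub> transport g"
      using fg by (intro transport_eqI) (auto simp: cl End_apply End_closed)
    show "transport (f \<oplus>\<^bsub>End_alg V\<^esub> g) = transport f \<oplus>\<^bsub>End_alg W\<^esub> transport g"
      using fg by (intro transport_eqI) (auto simp: cl End_apply End_closed transfer_add)
  next
    show "transport \<one>\<^bsub>End_alg V\<^esub> = \<one>\<^bsub>End_alg W\<^esub>" by (intro transport_eqI) (auto simp: cl End_apply)
  qed auto
  moreover have "bij_betw transport (carrier (End_alg V)) (carrier (End_alg W))"
    by (rule bij_betwI[where g = sym.transport]) (auto simp: transport_inverse sym.transport_inverse)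
  moreover have "transport (c \<odot>\<^bsub>End_alg V\<^esub> f) = c \<odot>\<^bsub>End_alg W\<^esub> transport f" if "f \<in> carrier (End_alg V)" for c f
    using that by (intro transport_eqI) (auto simp: cl End_apply End_closed transfer_smult)
  ultimately show ?thesis by (auto simp: alg_iso_def ring_iso_def)
qed

lemma (in two_frames) eigsp_transport:
  assumes f: "f \<in> carrier (End_alg V)" and x: "x \<in> carrier V"
  shows "transfer x \<in> eigsp W (transport f) c \<longleftrightarrow> x \<in> eigsp V f c"
  using assms by (simp add: eigsp_def transfer_smult[symmetric] transfer_inj End_closed)

lemma (in two_frames) eigvals_transport:
  assumes f: "f \<in> carrier (End_alg V)"
  shows "eigvals W (transport f) = eigvals V f"
proof -
  have "(\<exists>y\<in>eigsp W (transport f) c. y \<noteq> \<zero>\<^bsub>W\<^esub>) \<longleftrightarrow> (\<exists>x\<in>eigsp V f c. x \<noteq> \<zero>\<^bsub>V\<^esub>)" for c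
  proof
    assume "\<exists>y\<in>eigsp W (transport f) c. y \<noteq> \<zero>\<^bsub>W\<^esub>"
    then obtain y where y: "y \<in> eigsp W (transport f) c" "y \<noteq> \<zero>\<^bsub>W\<^esub>" by blast
    then obtain x where x: "x \<in> carrier V" "y = transfer x"
      by (auto simp: eigsp_def elim: transfer_cases)
    then have "x \<in> eigsp V f c" "x \<noteq> \<zero>\<^bsub>V\<^esub>"
      using y eigsp_transport[OF f x(1)] transfer_zero by auto
    then show "\<exists>x\<in>eigsp V f c. x \<noteq> \<zero>\<^bsub>V\<^esub>" by blast
  next
    assume "\<exists>x\<in>eigsp V f c. x \<noteq> \<zero>\<^bsub>V\<^esub>"
    then obtain x where x: "x \<in> eigsp V f c" "x \<noteq> \<zero>\<^bsub>V\<^esub>" by blast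
    then have "x \<in> carrier V" by (simp add: eigsp_def)
    then show "\<exists>y\<in>eigsp W (transport f) c. y \<noteq> \<zero>\<^bsub>W\<^esub>"
      using x eigsp_transport[OF f, of x] transfer_inj[of x "\<zero>\<^bsub>V\<^esub>"] transfer_zero by force
  qed
  then show ?thesis by (simp add: eigvals_def)
qed

lemma (in two_frames) prim_idem_transport:
  assumes f: "f \<in> carrier (End_alg V)" and e: "prim_idem V f c e"
  shows "prim_idem W (transport f) c (transport e)"
  unfolding prim_idem_def eigvals_transport[OF f]
proof (intro conjI ballI impI)
  have e_in: "e \<in> carrier (End_alg V)" using e by (simp add: prim_idem_def)
  then show "transport e \<in> carrier (End_alg W)" by simp
  show "c \<in> eigvals V f" using e by (simp add: prim_idem_def)
  fix y assume y: "y \<in> eigsp W (transport f) c"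
  then obtain x where x: "x \<in> carrier V" "y = transfer x" by (auto simp: eigsp_def elim: transfer_cases)
  then have "e x = x" using e y eigsp_transport[OF f] by (simp add: prim_idem_def)
  then show "transport e y = y" using x by simp
next
  fix c' y assume c': "c' \<in> eigvals V f" "c' \<noteq> c" and y: "y \<in> eigsp W (transport f) c'"
  then obtain x where x: "x \<in> carrier V" "y = transfer x" by (auto simp: eigsp_def elim: transfer_cases)
  then have "e x = \<zero>\<^bsub>V\<^esub>" using e c' y eigsp_transport[OF f] by (simp add: prim_idem_def)
  then show "transport e y = \<zero>\<^bsub>W\<^esub>" using x transfer_zero by simp
qed

text \<open>Matching the two split bases takes \<open>A\<close> and \<open>As\<close> to their counterparts, because the bidiagonal
  matrices contain nothing but the parameter array. The idempotents follow, since a primitive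
  idempotent is determined by its map and its eigenvalue.\<close>
lemma parr_eq_imp_isomorphic:
  assumes S: "split_frame (sp \<Phi>) d v a (opA \<Phi>) (idE \<Phi>) \<theta> e b (opAs \<Phi>) (idEs \<Phi>) \<theta>s u p \<phi>"
    and S': "split_frame (sp \<Psi>) d v' a' (opA \<Psi>) (idE \<Psi>) \<theta>' e' b' (opAs \<Psi>) (idEs \<Psi>) \<theta>s' u' p' \<phi>'"
    and eq: "parr_of d \<Phi> = parr_of d \<Psi>"
  shows "th_isomorphic d \<Phi> \<Psi>"
proof -
  interpret S: split_frame "sp \<Phi>" d v a "opA \<Phi>" "idE \<Phi>" \<theta> e b "opAs \<Phi>" "idEs \<Phi>" \<theta>s u p \<phi> by (rule S)
  interpret S': split_frame "sp \<Psi>" d v' a' "opA \<Psi>" "idE \<Psi>" \<theta>' e' b' "opAs \<Psi>" "idEs \<Psi>" \<theta>s' u' p' \<phi>' by (rule S')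
  interpret two_frames "sp \<Phi>" d u p "sp \<Psi>" u' p' ..
  have "restrict \<theta> {0..d} = restrict \<theta>' {0..d}" "restrict \<theta>s {0..d} = restrict \<theta>s' {0..d}"
    "restrict \<phi> {1..d} = restrict \<phi>' {1..d}"
    using eq S.parr_of_eq[of \<Phi>] S'.parr_of_eq[of \<Psi>] by auto
  then have \<theta>: "\<theta> i = \<theta>' i" and \<theta>s: "\<theta>s i = \<theta>s' i" and \<phi>: "1 \<le> i \<Longrightarrow> \<phi> i = \<phi>' i" if "i \<le> d" for i
    using that by (metis restrict_apply' atLeastAtMost_iff le0, metis restrict_apply' atLeastAtMost_iff le0,
        metis restrict_apply' atLeastAtMost_iff)
  have A: "transport (opA \<Phi>) = opA \<Psi>"
    by (intro transport_eqI S'.U.a_eqI) (auto simp: S'.p_A S.p_A \<theta>)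
  have As: "transport (opAs \<Phi>) = opAs \<Psi>"
    by (intro transport_eqI S'.U.a_eqI) (auto simp: S'.p_As S.p_As \<theta>s \<phi>)
  have E: "transport (idE \<Phi> i) = idE \<Psi> i" if i: "i \<le> d" for i
  proof -
    have "prim_idem (sp \<Psi>) (opA \<Psi>) (\<theta>' i) (transport (idE \<Phi> i))"
      using prim_idem_transport[OF S.A.A_in S.A.prim_idem_E[OF i]] i by (simp add: A \<theta>)
    then obtain j where "j \<le> d" "\<theta>' i = \<theta>' j" "transport (idE \<Phi> i) = idE \<Psi> j"
      by (rule S'.A.prim_idem_unique)
    then show ?thesis using inj_onD[OF S'.A.\<theta>_inj, of i j] i by auto
  qed
  have Es: "transport (idEs \<Phi> i) = idEs \<Psi> i" if i: "i \<le> d" for i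
  proof -
    have "prim_idem (sp \<Psi>) (opAs \<Psi>) (\<theta>s' i) (transport (idEs \<Phi> i))"
      using prim_idem_transport[OF S.B.A_in S.B.prim_idem_E[OF i]] i by (simp add: As \<theta>s)
    then obtain j where "j \<le> d" "\<theta>s' i = \<theta>s' j" "transport (idEs \<Phi> i) = idEs \<Psi> j"
      by (rule S'.B.prim_idem_unique)
    then show ?thesis using inj_onD[OF S'.B.\<theta>_inj, of i j] i by auto
  qed
  show ?thesis unfolding th_isomorphic_def
    by (rule bexI[OF _ transport_alg_iso]) (simp add: A As E Es)
qed

section \<open>Affine transformations of the split basis\<close>

text \<open>The eigenbases stay the same. The split vector \<open>u i\<close> is a product of \<open>i\<close> shifted copies of
  \<open>A\<close> applied to \<open>e 0\<close>, so it picks up the factor \<open>\<alpha> ^ i\<close>.\<close>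
lemma (in split_frame) split_frame_affine:
  assumes nz: "\<alpha> \<noteq> 0" "\<alpha>s \<noteq> 0"
    and A': "A' \<in> carrier (End_alg V)" "\<And>x. x \<in> carrier V \<Longrightarrow> A' x = \<alpha> \<odot>\<^bsub>V\<^esub> A x \<oplus>\<^bsub>V\<^esub> \<beta> \<odot>\<^bsub>V\<^esub> x"
    and As': "As' \<in> carrier (End_alg V)" "\<And>x. x \<in> carrier V \<Longrightarrow> As' x = \<alpha>s \<odot>\<^bsub>V\<^esub> As x \<oplus>\<^bsub>V\<^esub> \<beta>s \<odot>\<^bsub>V\<^esub> x"
  shows "split_frame V d v a A' E (\<lambda>i. \<alpha> * \<theta> i + \<beta>) e b As' Es (\<lambda>i. \<alpha>s * \<theta>s i + \<beta>s)
    (\<lambda>i. \<alpha> ^ i \<odot>\<^bsub>V\<^esub> u i) (\<lambda>x k. p x k / \<alpha> ^ k) (\<lambda>i. \<alpha> * \<alpha>s * \<phi> i)"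
proof -
  interpret A': eigenframe V d v a A' E "\<lambda>i. \<alpha> * \<theta> i + \<beta>"
    by unfold_locales (use A' nz A.E_ext A.\<theta>_inj in \<open>auto simp: algebra_simps inj_on_def\<close>)
  interpret As': eigenframe V d e b As' Es "\<lambda>i. \<alpha>s * \<theta>s i + \<beta>s"
    by unfold_locales (use As' nz B.E_ext B.\<theta>_inj in \<open>auto simp: algebra_simps inj_on_def\<close>)
  interpret T: th_frame V d v a A' E "\<lambda>i. \<alpha> * \<theta> i + \<beta>" e b As' Es "\<lambda>i. \<alpha>s * \<theta>s i + \<beta>s"
  proof
    show "raises V d a As'"
      using As_raises nz unfolding A.raises_iff[OF As'(1)] A.raises_iff[OF B.A_in]
      by (auto simp: As'(2) A.a_v)
    show "raises V d b A'"
      using A_raises nz unfolding B.raises_iff[OF A'(1)] B.raises_iff[OF A.A_in]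
      by (auto simp: A'(2) B.a_v)
  qed
  interpret U': frame V d "\<lambda>i. \<alpha> ^ i \<odot>\<^bsub>V\<^esub> u i" "\<lambda>x k. p x k / \<alpha> ^ k"
  proof
    fix x y assume "x \<in> carrier V" "y \<in> carrier V" "\<And>k. k \<le> d \<Longrightarrow> p x k / \<alpha> ^ k = p y k / \<alpha> ^ k"
    then show "x = y" using nz by (intro U.a_eqI) auto
  qed (use nz in \<open>auto simp: U.a_v add_divide_distrib\<close>)
  show ?thesis
  proof
    show "same_flag V d b (\<lambda>x k. p x k / \<alpha> ^ k)"
      using flag_b nz by (simp add: same_flag_def vanishes_from_def)
    show "same_flag V d a (\<lambda>x k. p x (d - k) / \<alpha> ^ (d - k))"
      using flag_a nz by (simp add: same_flag_def vanishes_from_def)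
  next
    fix x k assume x: "x \<in> carrier V" "k \<le> d"
    show "p (A' x) k / \<alpha> ^ k = (\<alpha> * \<theta> (d - k) + \<beta>) * (p x k / \<alpha> ^ k)
        + (if k = 0 then 0 else p x (k - 1) / \<alpha> ^ (k - 1))"
      using x nz by (cases k) (auto simp: A'(2) p_A field_simps)
    show "p (As' x) k / \<alpha> ^ k = (\<alpha>s * \<theta>s k + \<beta>s) * (p x k / \<alpha> ^ k)
        + (if k < d then \<alpha> * \<alpha>s * \<phi> (Suc k) * (p x (Suc k) / \<alpha> ^ Suc k) else 0)"
      using x nz by (auto simp: As'(2) p_As field_simps)
  qed (use \<phi>_nonzero nz in auto)
qed

section \<open>Every parameter array occurs\<close>

text \<open>The bidiagonal matrices prescribed by the array are diagonalizable by triangular changes of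
  basis: \<open>As\<close> is upper triangular in the basis \<open>u\<close> with diagonal \<open>\<theta>s\<close>, and \<open>A\<close> is upper triangular
  in the reversed basis with diagonal \<open>\<theta>\<close>. Moreover \<open>A\<close> raises the flag of \<open>u\<close> because its
  subdiagonal entries are \<open>1\<close>, and \<open>As\<close> raises the flag of the reversed basis because the \<open>\<phi> i\<close>
  are non-zero. The eigenbases have these same flags.\<close>
lemma split_frame_of_parr:
  assumes dim: "has_dim V (d + 1)" and P: "(\<theta>, \<theta>s, \<phi>) \<in> param_arrays d"
  shows "\<exists>v a A E e b As Es u p. split_frame V d v a A E \<theta> e b As Es \<theta>s u p \<phi>"
proof -
  obtain u p where "frame V d u p" using frame_exists[OF dim] by blast
  then interpret U: frame V d u p .
  have inj: "inj_on \<theta> {0..d}" "inj_on \<theta>s {0..d}" and nz: "\<And>i. i \<in> {1..d} \<Longrightarrow> \<phi> i \<noteq> 0"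
    using P by (auto simp: param_arrays_def)
  define A where "A = (\<lambda>x\<in>carrier V. U.vec_of (\<lambda>k. \<theta> (d - k) * p x k + (if k = 0 then 0 else p x (k - 1))))"
  define As where "As = (\<lambda>x\<in>carrier V. U.vec_of (\<lambda>k. \<theta>s k * p x k + (if k < d then \<phi> (Suc k) * p x (Suc k) else 0)))"
  have A_in: "A \<in> carrier (End_alg V)"
    unfolding A_def by (rule U.linear_EndI) (auto simp: algebra_simps)
  have As_in: "As \<in> carrier (End_alg V)"
    unfolding As_def by (rule U.linear_EndI) (auto simp: algebra_simps)
  have p_A: "p (A x) k = \<theta> (d - k) * p x k + (if k = 0 then 0 else p x (k - 1))"
    and p_As: "p (As x) k = \<theta>s k * p x k + (if k < d then \<phi> (Suc k) * p x (Suc k) else 0)"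
    if "x \<in> carrier V" "k \<le> d" for x k
    using that by (simp_all add: A_def As_def)
  let ?q = "\<lambda>x k. p x (d - k)"
  interpret R: frame V d "\<lambda>i. u (d - i)" ?q
    by (rule U.reindex) (rule bij_betwI[where g = "\<lambda>i. d - i"]; auto)
  have "vanishes_from d ?q (Suc i) (A (u (d - i)))" "?q (A (u (d - i))) i = \<theta> i" if "i \<le> d" for i
    using that by (auto simp: vanishes_from_def p_A U.a_v)
  from R.triangular_diagonalize[OF A_in this inj(1)]
  obtain v a E where A: "eigenframe V d v a A E \<theta>" and flag_a: "same_flag V d ?q a" by blast
  have "vanishes_from d p (Suc i) (As (u i))" "p (As (u i)) i = \<theta>s i" if "i \<le> d" for i
    using that by (auto simp: vanishes_from_def p_As U.a_v)
  from U.triangular_diagonalize[OF As_in this inj(2)]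
  obtain e b Es where B: "eigenframe V d e b As Es \<theta>s" and flag_b: "same_flag V d p b" by blast
  have "raises V d p A" unfolding U.raises_iff[OF A_in]
    by (auto simp: p_A U.a_v)
  then have A_raises: "raises V d b A" by (rule raises_same_flag[OF flag_b _ A_in])
  have "raises V d ?q As" unfolding R.raises_iff[OF As_in]
    by (auto simp: p_As U.a_v Suc_diff_Suc intro!: nz)
  then have As_raises: "raises V d a As" by (rule raises_same_flag[OF flag_a _ As_in])
  have "split_frame V d v a A E \<theta> e b As Es \<theta>s u p \<phi>"
    by (intro split_frame.intro th_frame.intro th_frame_axioms.intro split_frame_axioms.intro
        A B A_raises As_raises same_flag_sym[OF flag_a] same_flag_sym[OF flag_b] p_A p_As nz U.frame_axioms)
  then show ?thesis by blast
qed

section \<open>The map from TH systems to parameter arrays\<close>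
lemma TH_system_split_frame:
  assumes "\<Phi> \<in> TH_systems d"
  obtains v a \<theta> e b \<theta>s u p \<phi> where
    "split_frame (sp \<Phi>) d v a (opA \<Phi>) (idE \<Phi>) \<theta> e b (opAs \<Phi>) (idEs \<Phi>) \<theta>s u p \<phi>"
proof -
  obtain v a \<theta> e b \<theta>s where "th_frame (sp \<Phi>) d v a (opA \<Phi>) (idE \<Phi>) \<theta> e b (opAs \<Phi>) (idEs \<Phi>) \<theta>s"
    using assms unfolding TH_systems_iff by blast
  from th_frame.split_frame_exists[OF this] show ?thesis by (elim exE) (rule that)
qed

lemma split_frame_TH_system:
  assumes "split_frame (sp \<Phi>) d v a (opA \<Phi>) (idE \<Phi>) \<theta> e b (opAs \<Phi>) (idEs \<Phi>) \<theta>s u p \<phi>"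
  shows "\<Phi> \<in> TH_systems d"
  using assms unfolding TH_systems_iff split_frame_def by blast

lemma parr_of_in_param_arrays:
  assumes "\<Phi> \<in> TH_systems d"
  shows "parr_of d \<Phi> \<in> param_arrays d"
  using assms
proof (rule TH_system_split_frame)
  fix v a \<theta> e b \<theta>s u p \<phi>
  assume "split_frame (sp \<Phi>) d v a (opA \<Phi>) (idE \<Phi>) \<theta> e b (opAs \<Phi>) (idEs \<Phi>) \<theta>s u p \<phi>"
  then interpret split_frame "sp \<Phi>" d v a "opA \<Phi>" "idE \<Phi>" \<theta> e b "opAs \<Phi>" "idEs \<Phi>" \<theta>s u p \<phi> .
  show ?thesis using parr_of_eq[of \<Phi>] in_param_arrays by simp
qed

lemma isomorphic_iff_parr_eq:
  assumes "\<Phi> \<in> TH_systems d" "\<Psi> \<in> TH_systems d"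
  shows "th_isomorphic d \<Phi> \<Psi> \<longleftrightarrow> parr_of d \<Phi> = parr_of d \<Psi>"
  using isomorphic_imp_parr_eq parr_eq_imp_isomorphic
    TH_system_split_frame[OF assms(1)] TH_system_split_frame[OF assms(2)] by metis

lemma parr_of_surj:
  assumes "has_dim (V :: ('k::field, 'v) module) (d + 1)" and P: "P \<in> param_arrays d"
  shows "\<exists>\<Phi> :: ('k, 'v) th_sys. \<Phi> \<in> TH_systems d \<and> parr_of d \<Phi> = P"
proof -
  obtain \<theta> \<theta>s \<phi> where P': "P = (\<theta>, \<theta>s, \<phi>)" by (metis prod_cases3)
  obtain v a A E e b As Es u p where S: "split_frame V d v a A E \<theta> e b As Es \<theta>s u p \<phi>"
    using split_frame_of_parr[OF assms(1) P[unfolded P']] by (elim exE)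
  let ?\<Phi> = "\<lparr>sp = V, opA = A, idE = E, opAs = As, idEs = Es\<rparr>"
  have "?\<Phi> \<in> TH_systems d" using split_frame_TH_system[of ?\<Phi>] S by simp
  moreover have "parr_of d ?\<Phi> = P"
    using split_frame.parr_of_eq[OF S, of ?\<Phi>] P by (simp add: P' param_arrays_def extensional_restrict)
  ultimately show ?thesis by blast
qed

section \<open>Affine relatedness and affine isomorphism\<close>

text \<open>Restricting to the index sets yields extensional functions, so affine relatedness becomes an
  equation between arrays.\<close>
definition affine_parr :: "nat \<Rightarrow> 'k \<Rightarrow> 'k \<Rightarrow> 'k \<Rightarrow> 'k \<Rightarrow> 'k::field parr \<Rightarrow> 'k parr" where
  "affine_parr d \<alpha> \<beta> \<alpha>s \<beta>s = (\<lambda>(\<theta>, \<theta>s, \<phi>).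
     (\<lambda>i\<in>{0..d}. \<alpha> * \<theta> i + \<beta>, \<lambda>i\<in>{0..d}. \<alpha>s * \<theta>s i + \<beta>s, \<lambda>i\<in>{1..d}. \<alpha> * \<alpha>s * \<phi> i))"

lemma affine_related_iff:
  "(P, Q) \<in> affine_related d \<longleftrightarrow> P \<in> param_arrays d \<and> Q \<in> param_arrays d \<and>
     (\<exists>\<alpha> \<beta> \<alpha>s \<beta>s. \<alpha> \<noteq> 0 \<and> \<alpha>s \<noteq> 0 \<and> Q = affine_parr d \<alpha> \<beta> \<alpha>s \<beta>s P)"
proof -
  obtain \<theta> \<theta>s \<phi> \<theta>' \<theta>s' \<phi>' where PQ: "P = (\<theta>, \<theta>s, \<phi>)" "Q = (\<theta>', \<theta>s', \<phi>')"
    by (metis prod_cases3)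
  have eq: "f = restrict g I \<longleftrightarrow> (\<forall>i\<in>I. f i = g i)" if "f \<in> extensional I" for f g :: "nat \<Rightarrow> 'a" and I
    using that by (auto intro: extensionalityI)
  have key: "Q = affine_parr d \<alpha> \<beta> \<alpha>s \<beta>s P \<longleftrightarrow>
      (\<forall>i\<in>{0..d}. \<theta>' i = \<alpha> * \<theta> i + \<beta> \<and> \<theta>s' i = \<alpha>s * \<theta>s i + \<beta>s) \<and> (\<forall>i\<in>{1..d}. \<phi>' i = \<alpha> * \<alpha>s * \<phi> i)"
    if "Q \<in> param_arrays d" for \<alpha> \<beta> \<alpha>s \<beta>s
    using that by (auto simp: PQ affine_parr_def param_arrays_def eq)
  show ?thesis
  proof (cases "Q \<in> param_arrays d")
    case True
    show ?thesis unfolding key[OF True] unfolding affine_related_def PQ by auto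
  qed (simp add: affine_related_def PQ)
qed

lemma parr_of_affine:
  assumes \<Phi>: "\<Phi> \<in> TH_systems d" and nz: "\<alpha> \<noteq> 0" "\<alpha>s \<noteq> 0"
  shows "th_affine \<alpha> \<beta> \<alpha>s \<beta>s \<Phi> \<in> TH_systems d"
    and "parr_of d (th_affine \<alpha> \<beta> \<alpha>s \<beta>s \<Phi>) = affine_parr d \<alpha> \<beta> \<alpha>s \<beta>s (parr_of d \<Phi>)"
proof -
  obtain v a \<theta> e b \<theta>s u p \<phi> where
    "split_frame (sp \<Phi>) d v a (opA \<Phi>) (idE \<Phi>) \<theta> e b (opAs \<Phi>) (idEs \<Phi>) \<theta>s u p \<phi>"
    using \<Phi> by (rule TH_system_split_frame)
  then interpret S: split_frame "sp \<Phi>" d v a "opA \<Phi>" "idE \<Phi>" \<theta> e b "opAs \<Phi>" "idEs \<Phi>" \<theta>s u p \<phi> .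
  let ?\<Psi> = "th_affine \<alpha> \<beta> \<alpha>s \<beta>s \<Phi>"
  have sel: "sp ?\<Psi> = sp \<Phi>" "idE ?\<Psi> = idE \<Phi>" "idEs ?\<Psi> = idEs \<Phi>"
    by (simp_all add: th_affine_def Let_def)
  have "opA ?\<Psi> \<in> carrier (End_alg (sp \<Phi>))" "opAs ?\<Psi> \<in> carrier (End_alg (sp \<Phi>))"
    "\<And>x. x \<in> carrier (sp \<Phi>) \<Longrightarrow> opA ?\<Psi> x = \<alpha> \<odot>\<^bsub>sp \<Phi>\<^esub> opA \<Phi> x \<oplus>\<^bsub>sp \<Phi>\<^esub> \<beta> \<odot>\<^bsub>sp \<Phi>\<^esub> x"
    "\<And>x. x \<in> carrier (sp \<Phi>) \<Longrightarrow> opAs ?\<Psi> x = \<alpha>s \<odot>\<^bsub>sp \<Phi>\<^esub> opAs \<Phi> x \<oplus>\<^bsub>sp \<Phi>\<^esub> \<beta>s \<odot>\<^bsub>sp \<Phi>\<^esub> x"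
    by (simp_all add: th_affine_def Let_def S.A.End_alg_closed End_apply)
  then have T: "split_frame (sp \<Phi>) d v a (opA ?\<Psi>) (idE \<Phi>) (\<lambda>i. \<alpha> * \<theta> i + \<beta>) e b (opAs ?\<Psi>) (idEs \<Phi>)
      (\<lambda>i. \<alpha>s * \<theta>s i + \<beta>s) (\<lambda>i. \<alpha> ^ i \<odot>\<^bsub>sp \<Phi>\<^esub> u i) (\<lambda>x k. p x k / \<alpha> ^ k) (\<lambda>i. \<alpha> * \<alpha>s * \<phi> i)"
    using nz by (intro S.split_frame_affine)
  show "?\<Psi> \<in> TH_systems d" using split_frame_TH_system[of ?\<Psi>] T by (simp add: sel)
  show "parr_of d ?\<Psi> = affine_parr d \<alpha> \<beta> \<alpha>s \<beta>s (parr_of d \<Phi>)"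
    using split_frame.parr_of_eq[OF T, of ?\<Psi>] S.parr_of_eq[of \<Phi>]
    by (auto simp: sel affine_parr_def intro!: restrict_ext)
qed

lemma affine_parr_comp:
  "affine_parr d \<alpha> \<beta> \<alpha>s \<beta>s (affine_parr d \<gamma> \<delta> \<gamma>s \<delta>s P) =
   affine_parr d (\<alpha> * \<gamma>) (\<alpha> * \<delta> + \<beta>) (\<alpha>s * \<gamma>s) (\<alpha>s * \<delta>s + \<beta>s) P"
  by (cases P) (auto simp: affine_parr_def algebra_simps intro!: restrict_ext)

lemma affine_parr_id:
  assumes "P \<in> param_arrays d" shows "affine_parr d 1 0 1 0 P = P"
  using assms by (auto simp: affine_parr_def param_arrays_def extensional_restrict)

lemma equiv_affine_related: "equiv (param_arrays d) (affine_related d :: ('k::field parr \<times> 'k parr) set)"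
proof (rule equivI)
  show "affine_related d \<subseteq> param_arrays d \<times> (param_arrays d :: 'k parr set)"
    by (auto simp: affine_related_iff)
  show "refl_on (param_arrays d) (affine_related d :: ('k parr \<times> 'k parr) set)"
  proof (rule refl_onI)
    fix P :: "'k parr" assume "P \<in> param_arrays d"
    then show "(P, P) \<in> affine_related d"
      unfolding affine_related_iff
      by (intro conjI exI[of _ 1] exI[of _ 0]) (auto simp: affine_parr_id)
  qed
  show "sym (affine_related d :: ('k parr \<times> 'k parr) set)"
  proof (rule symI)
    fix P Q :: "'k parr" assume PQ: "(P, Q) \<in> affine_related d"
    then obtain \<alpha> \<beta> \<alpha>s \<beta>s where nz: "\<alpha> \<noteq> 0" "\<alpha>s \<noteq> 0" and Q: "Q = affine_parr d \<alpha> \<beta> \<alpha>s \<beta>s P"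
      by (auto simp: affine_related_iff)
    have "affine_parr d (1 / \<alpha>) (- \<beta> / \<alpha>) (1 / \<alpha>s) (- \<beta>s / \<alpha>s) Q = P"
      using nz PQ by (simp add: Q affine_parr_comp affine_parr_id affine_related_iff)
    then show "(Q, P) \<in> affine_related d"
      using PQ nz unfolding affine_related_iff
      by (intro conjI exI[of _ "1 / \<alpha>"] exI[of _ "- \<beta> / \<alpha>"] exI[of _ "1 / \<alpha>s"] exI[of _ "- \<beta>s / \<alpha>s"]) auto
  qed
  show "trans (affine_related d :: ('k parr \<times> 'k parr) set)"
  proof (rule transI)
    fix P Q R :: "'k parr" assume PQ: "(P, Q) \<in> affine_related d" and QR: "(Q, R) \<in> affine_related d"
    obtain \<alpha> \<beta> \<alpha>s \<beta>s where nz: "\<alpha> \<noteq> 0" "\<alpha>s \<noteq> 0" and Q: "Q = affine_parr d \<alpha> \<beta> \<alpha>s \<beta>s P"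
      using PQ by (auto simp: affine_related_iff)
    obtain \<gamma> \<delta> \<gamma>s \<delta>s where nz': "\<gamma> \<noteq> 0" "\<gamma>s \<noteq> 0" and R: "R = affine_parr d \<gamma> \<delta> \<gamma>s \<delta>s Q"
      using QR by (auto simp: affine_related_iff)
    have "\<gamma> * \<alpha> \<noteq> 0" "\<gamma>s * \<alpha>s \<noteq> 0" using nz nz' by auto
    moreover have "R = affine_parr d (\<gamma> * \<alpha>) (\<gamma> * \<beta> + \<delta>) (\<gamma>s * \<alpha>s) (\<gamma>s * \<beta>s + \<delta>s) P"
      by (simp only: R Q affine_parr_comp)
    ultimately show "(P, R) \<in> affine_related d"
      using PQ QR unfolding affine_related_iff by blast
  qed
qed

text \<open>Affine isomorphism transforms the second system, affine relatedness the first array; the two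
  conventions agree because affine relatedness is symmetric.\<close>
lemma affine_isomorphic_iff:
  assumes "\<Phi> \<in> TH_systems d" "\<Psi> \<in> TH_systems d"
  shows "(\<Phi>, \<Psi>) \<in> th_affine_iso_rel d \<longleftrightarrow> (parr_of d \<Phi>, parr_of d \<Psi>) \<in> affine_related d"
proof -
  have "(\<Phi>, \<Psi>) \<in> th_affine_iso_rel d \<longleftrightarrow>
      (\<exists>\<alpha> \<beta> \<alpha>s \<beta>s. \<alpha> \<noteq> 0 \<and> \<alpha>s \<noteq> 0 \<and> parr_of d \<Phi> = affine_parr d \<alpha> \<beta> \<alpha>s \<beta>s (parr_of d \<Psi>))"
  proof -
    have "th_affine \<alpha> \<beta> \<alpha>s \<beta>s \<Psi> \<in> TH_systems d \<and> th_isomorphic d \<Phi> (th_affine \<alpha> \<beta> \<alpha>s \<beta>s \<Psi>)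
        \<longleftrightarrow> parr_of d \<Phi> = affine_parr d \<alpha> \<beta> \<alpha>s \<beta>s (parr_of d \<Psi>)"
      if "\<alpha> \<noteq> 0" "\<alpha>s \<noteq> 0" for \<alpha> \<beta> \<alpha>s \<beta>s
      using parr_of_affine[OF assms(2) that, of \<beta> \<beta>s]
        isomorphic_iff_parr_eq[OF assms(1), of "th_affine \<alpha> \<beta> \<alpha>s \<beta>s \<Psi>"] by simp
    then show ?thesis using assms unfolding th_affine_iso_rel_def by blast
  qed
  also have "\<dots> \<longleftrightarrow> (parr_of d \<Psi>, parr_of d \<Phi>) \<in> affine_related d"
    using assms by (simp add: affine_related_iff parr_of_in_param_arrays)
  also have "\<dots> \<longleftrightarrow> (parr_of d \<Phi>, parr_of d \<Psi>) \<in> affine_related d"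
    using equiv_affine_related[of d] by (meson equiv_def symE)
  finally show ?thesis .
qed

section \<open>The two bijections\<close>
lemma quotient_by_kernel:
  fixes p :: "'a \<Rightarrow> 'b"
  assumes R: "\<And>x y. (x, y) \<in> R \<longleftrightarrow> x \<in> T \<and> y \<in> T \<and> p x = p y"
  shows "\<exists>F. (\<forall>x\<in>T. F (R `` {x}) = p x) \<and> bij_betw F (T // R) (p ` T)"
proof -
  define F where "F X = the_elem (p ` X)" for X
  have F: "F (R `` {x}) = p x" if "x \<in> T" for x
  proof -
    have "p ` (R `` {x}) = {p x}" using that R by auto
    then show ?thesis by (simp add: F_def)
  qed
  have "inj_on F (T // R)"
  proof (rule inj_onI)
    fix X Y assume "X \<in> T // R" "Y \<in> T // R" "F X = F Y"
    then obtain x y where "x \<in> T" "y \<in> T" "X = R `` {x}" "Y = R `` {y}" "p x = p y"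
      by (auto simp: quotient_def F)
    then show "X = Y" by (auto simp: R)
  qed
  moreover have "F ` (T // R) = p ` T"
    by (auto simp: quotient_def F image_iff)
  ultimately have "bij_betw F (T // R) (p ` T)" by (simp add: bij_betw_def)
  with F show ?thesis by blast
qed

theorem corollary19p14:
  fixes d :: nat
  assumes "\<exists>V :: ('k::field, 'v) module. has_dim V (d + 1)"
  shows "\<exists>(F :: ('k, 'v) th_sys set \<Rightarrow> 'k parr) (G :: ('k, 'v) th_sys set \<Rightarrow> 'k parr set).
      (\<forall>\<Phi>\<in>TH_systems d. F (th_iso_rel d `` {\<Phi>}) = parr_of d \<Phi>)
    \<and> bij_betw F (TH_systems d // th_iso_rel d) (param_arrays d)
    \<and> (\<forall>\<Phi>\<in>TH_systems d.
          G (th_affine_iso_rel d `` {\<Phi>}) = affine_related d `` {F (th_iso_rel d `` {\<Phi>})})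
    \<and> bij_betw G (TH_systems d // th_affine_iso_rel d) (param_arrays d // affine_related d)"
proof -
  let ?T = "TH_systems d :: ('k, 'v) th_sys set"
  have im: "parr_of d ` ?T = param_arrays d"
  proof (intro equalityI subsetI)
    fix P :: "'k parr" assume "P \<in> param_arrays d"
    moreover obtain V :: "('k, 'v) module" where "has_dim V (d + 1)" using assms by blast
    ultimately obtain \<Phi> :: "('k, 'v) th_sys" where "\<Phi> \<in> TH_systems d" "parr_of d \<Phi> = P"
      using parr_of_surj by blast
    then show "P \<in> parr_of d ` ?T" by blast
  qed (auto simp: parr_of_in_param_arrays)
  have "(\<Phi>, \<Psi>) \<in> th_iso_rel d \<longleftrightarrow> \<Phi> \<in> ?T \<and> \<Psi> \<in> ?T \<and> parr_of d \<Phi> = parr_of d \<Psi>" for \<Phi> \<Psi>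
    by (auto simp: th_iso_rel_def isomorphic_iff_parr_eq)
  from quotient_by_kernel[OF this] obtain F where F: "\<forall>\<Phi>\<in>?T. F (th_iso_rel d `` {\<Phi>}) = parr_of d \<Phi>"
    "bij_betw F (?T // th_iso_rel d) (param_arrays d)"
    unfolding im by blast
  \<comment> \<open>Affine isomorphism is the kernel of the map to reduced parameter arrays.\<close>
  let ?c = "\<lambda>\<Phi>. affine_related d `` {parr_of d \<Phi>}"
  have "(\<Phi>, \<Psi>) \<in> th_affine_iso_rel d \<longleftrightarrow> \<Phi> \<in> ?T \<and> \<Psi> \<in> ?T \<and> ?c \<Phi> = ?c \<Psi>" for \<Phi> \<Psi>
  proof (cases "\<Phi> \<in> ?T \<and> \<Psi> \<in> ?T")
    case True
    then show ?thesis
      using affine_isomorphic_iff[of \<Phi> d \<Psi>] parr_of_in_param_arrays[of \<Phi> d] parr_of_in_param_arrays[of \<Psi> d]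
        eq_equiv_class_iff[OF equiv_affine_related, of "parr_of d \<Phi>" d "parr_of d \<Psi>"] by simp
  qed (auto simp: th_affine_iso_rel_def)
  from quotient_by_kernel[OF this] obtain G where G: "\<forall>\<Phi>\<in>?T. G (th_affine_iso_rel d `` {\<Phi>}) = ?c \<Phi>"
    "bij_betw G (?T // th_affine_iso_rel d) (?c ` ?T)" by blast
  have "?c ` ?T = param_arrays d // affine_related d"
    unfolding im[symmetric] quotient_def by auto
  then show ?thesis using F G by (intro exI[of _ F] exI[of _ G]) simp
qed

end
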